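(* Let $K$ be a compact line and let $M(K)$ be the set of all internal points of $K$ of uncountable character. If $C(K)$ has the continuous separable complementation property, then $K$ is $\aleph_0$-monolithic and $\operatorname{io}(M(K))<\infty$. If moreover $C(K)$ has the continuous $k$-SCP for some $k<2$, then $M(K)=\emptyset$.
   Context: A compact line is a linearly ordered space that is compact in its order topology. A point $x$ of a compact line is external if it is isolated in $[x,\to)$ or in $(\leftarrow,x]$; otherwise it is internal. A point has uncountable character if it has no countable neighborhood base. A compact space is $\aleph_0$-monolithic if the closure of every countable subset is metrizable. For a Banach space $E$, $\operatorname{Sep}(E)$ is the set of closed separable linear subspaces ordered by inclusion; sequences $(S_n)$ have supremum $\overline{\operatorname{span}\bigcup_n S_n}$. A subset $\mathcal F\subseteq\operatorname{Sep}(E)$ is closed cofinal if every $S\in\operatorname{Sep}(E)$ is contained in some $F\in\mathcal F$, and whenever $F_1\subseteq F_2\subseteq\cdots$ are from $\mathcal F$ their supremum belongs to $\mathcal F$. $E$ has the continuous separable complementation property (continuous SCP) if there is a closed cofinal $\mathcal F\subseteq\operatorname{Sep}(E)$ formed by complemented subspaces (ranges of bounded linear projections on $E$); it has the continuous $k$-SCP ($k\geq 1$) if all members of such an $\mathcal F$ are ranges of projections of norm at most $k$. Internal order: let $X$ be a linearly ordered set and $A\subseteq X$. Put $\operatorname{io}(\emptyset)=-1$. If $A\neq\emptyset$, then for $x\in A$ define inductively: $\operatorname{io}(x,A)\ge 0$ always; for $n\ge1$, $\operatorname{io}(x,A)\ge n$ iff the sets $A^-_{n-1}=\{y\in A: y<x,\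 \operatorname{io}(y,A)\ge n-1\}$ and $A^+_{n-1}=\{y\in A:y>x,\ \operatorname{io}(y,A)\ge n-1\}$ are both nonempty and $\sup A^-_{n-1}=\inf A^+_{n-1}=x$. Then $\operatorname{io}(x,A)=\sup\{n\in\{0,1,2,\dots\}:\operatorname{io}(x,A)\ge n\}$ and $\operatorname{io}(A)=\sup\{\operatorname{io}(x,A):x\in A\}\in\{0,1,2,\dots\}\cup\{\infty\}$. *)

theory Defs
  imports "HOL-Analysis.Analysis" "HOL-Library.Lub_Glb"
begin

text \<open>
  A compact line is the universe of a type of class \<open>linorder_topology\<close> (linear order with its
  order topology) such that \<open>compact UNIV\<close>.  Its Banach space of continuous real functions under
  the supremum norm is \<open>'a \<Rightarrow>\<^sub>C real\<close>: boundedness is automatic on a compact space.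
\<close>

subsection \<open>Compact lines\<close>

definition external_point :: "'a::linorder_topology \<Rightarrow> bool" where
  "external_point x \<longleftrightarrow> x isolated_in {x..} \<or> x isolated_in {..x}"

abbreviation internal_point :: "'a::linorder_topology \<Rightarrow> bool" where
  "internal_point x \<equiv> \<not> external_point x"

definition countable_character :: "'a::topological_space \<Rightarrow> bool" where
  "countable_character x \<longleftrightarrow>
     (\<exists>\<B>. countable \<B> \<and> (\<forall>B\<in>\<B>. x \<in> interior B) \<and>
          (\<forall>U. open U \<and> x \<in> U \<longrightarrow> (\<exists>B\<in>\<B>. B \<subseteq> U)))"

definition internal_uncountable_points :: "'a::linorder_topology set" where
  "internal_uncountable_points = {x. internal_point x \<and> \<not> countable_character x}"

definition aleph0_monolithic :: "'a topology \<Rightarrow> bool" where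
  "aleph0_monolithic X \<longleftrightarrow>
     (\<forall>A. A \<subseteq> topspace X \<and> countable A \<longrightarrow> metrizable_space (subtopology X (X closure_of A)))"

subsection \<open>Separable complementation\<close>

text \<open>
  These notions are stated over \<open>real_normed_vector\<close> because the library provides completeness of
  \<open>'a \<Rightarrow>\<^sub>C 'b\<close> as a class instance only for metric domains \<open>'a\<close>.
\<close>

definition separable_subspaces :: "'e::real_normed_vector set set" where
  "separable_subspaces =
     {S. subspace S \<and> closed S \<and> (\<exists>D. countable D \<and> D \<subseteq> S \<and> S \<subseteq> closure D)}"

definition closed_cofinal :: "'e::real_normed_vector set set \<Rightarrow> bool" where
  "closed_cofinal \<F> \<longleftrightarrow>
     \<F> \<subseteq> separable_subspaces \<and>
     (\<forall>S\<in>separable_subspaces. \<exists>F\<in>\<F>. S \<subseteq> F) \<and>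
     (\<forall>F :: nat \<Rightarrow> 'e set. (\<forall>n. F n \<in> \<F>) \<and> (\<forall>n. F n \<subseteq> F (Suc n))
        \<longrightarrow> closure (span (\<Union>n. F n)) \<in> \<F>)"

definition bounded_projection :: "('e::real_normed_vector \<Rightarrow> 'e) \<Rightarrow> bool" where
  "bounded_projection P \<longleftrightarrow> bounded_linear P \<and> P \<circ> P = P"

definition complemented :: "'e::real_normed_vector set \<Rightarrow> bool" where
  "complemented S \<longleftrightarrow> (\<exists>P. bounded_projection P \<and> range P = S)"

definition continuous_SCP :: "'e::real_normed_vector itself \<Rightarrow> bool" where
  "continuous_SCP _ \<longleftrightarrow> (\<exists>\<F> :: 'e set set. closed_cofinal \<F> \<and> (\<forall>F\<in>\<F>. complemented F))"

definition continuous_k_SCP :: "real \<Rightarrow> 'e::real_normed_vector itself \<Rightarrow> bool" where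
  "continuous_k_SCP k _ \<longleftrightarrow>
     (\<exists>\<F> :: 'e set set. closed_cofinal \<F> \<and>
        (\<forall>F\<in>\<F>. \<exists>P. bounded_projection P \<and> range P = F \<and> onorm P \<le> k))"

subsection \<open>Internal order\<close>

text \<open>
  \<open>io_ge A n x\<close> expresses \<open>io(x, A) \<ge> n\<close> and is meaningful for \<open>x \<in> A\<close>.  Suprema and infima are
  taken in the whole ordered type, not in \<open>A\<close>.
\<close>

primrec io_ge :: "'a::linorder set \<Rightarrow> nat \<Rightarrow> 'a \<Rightarrow> bool" where
  "io_ge A 0 x \<longleftrightarrow> True"
| "io_ge A (Suc n) x \<longleftrightarrow>
     {y \<in> A. y < x \<and> io_ge A n y} \<noteq> {} \<and>
     {y \<in> A. y > x \<and> io_ge A n y} \<noteq> {} \<and>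
     isLub UNIV {y \<in> A. y < x \<and> io_ge A n y} x \<and>
     isGlb UNIV {y \<in> A. y > x \<and> io_ge A n y} x"

definition io_at :: "'a::linorder \<Rightarrow> 'a set \<Rightarrow> enat" where
  "io_at x A = Sup {enat n | n. io_ge A n x}"

definition io :: "'a::linorder set \<Rightarrow> ereal" where
  "io A = (if A = {} then -1 else ereal_of_enat (SUP x\<in>A. io_at x A))"

end

theory Submission
  imports Defs
begin

text \<open>
  Take a countable set \<open>N\<close> of points and a member \<open>F\<close> of the given family that
  are closed under suitable Skolem functions. A point \<open>x \<in> N\<close> of \<open>M\<close> is
  then blown up to a gap \<open>p < q\<close> across which every function of \<open>F\<close> takes equal
  values, while \<open>p\<close> and \<open>q\<close> are limits of points of \<open>N\<close> from
  outside. If \<open>P\<close> projects onto \<open>F\<close>, then \<open>I - P\<close> preserves the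
  jump across each gap, so it maps a step across the gap to a function that is bounded away from zero on
  one side of the gap. Nesting such one-sided neighbourhoods along internal orders \<open>n, n - 1,
  \<dots>, 0\<close> shows that \<open>\<parallel>P\<parallel>\<close> grows linearly with
  \<open>n\<close>; a single gap already forces \<open>\<parallel>P\<parallel> \<ge> 2\<close>. If the
  closure of a countable set is not metrizable, it has uncountably many jumps that \<open>F\<close>
  does not separate, and condensation makes these gaps of every finite rank.
\<close>

section \<open>Separable subspaces and closed cofinal families\<close>

text \<open>The closure of the rational span of \<open>B\<close> serves. Lists of coefficient-vector
  pairs code the rational combinations, so countability is immediate and addition is concatenation;
  density of the rationals makes the closure stable under real scalars.\<close>

lemma countable_subset_separable:
  fixes B :: "'e::real_normed_vector set"
  assumes "countable B"
  obtains S where "S \<in> separable_subspaces" and "B \<subseteq> S"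
proof
  let ?v = "\<lambda>xs. sum_list (map (\<lambda>(q, b). of_rat q *\<^sub>R b) xs) :: 'e"
  define D where "D = ?v ` lists (UNIV \<times> B)"
  have "countable D"
    using assms by (auto simp: D_def)
  have zero: "0 \<in> D"
    unfolding D_def by (rule image_eqI[where x = "[]"]) auto
  have add: "x + y \<in> D" if xy: "x \<in> D" "y \<in> D" for x y
  proof -
    from xy obtain xs ys where "xs \<in> lists (UNIV \<times> B)" "ys \<in> lists (UNIV \<times> B)" "x = ?v xs" "y = ?v ys"
      by (auto simp: D_def)
    then show ?thesis
      unfolding D_def by (intro image_eqI[where x = "xs @ ys"]) auto
  qed
  have scale: "of_rat r *\<^sub>R x \<in> D" if x: "x \<in> D" for x and r :: rat
  proof -
    from x obtain xs where xs: "xs \<in> lists (UNIV \<times> B)" "x = ?v xs"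
      by (auto simp: D_def)
    have "of_rat r *\<^sub>R ?v xs = ?v (map (\<lambda>(q, b). (r * q, b)) xs)"
      by (induction xs) (auto simp: scaleR_add_right of_rat_mult)
    with xs show ?thesis
      unfolding D_def by (intro image_eqI[where x = "map (\<lambda>(q, b). (r * q, b)) xs"]) auto
  qed
  have "subspace (closure D)"
  proof (rule subspaceI)
    show "0 \<in> closure D"
      using zero closure_subset by blast
  next
    fix x y assume "x \<in> closure D" "y \<in> closure D"
    then obtain f g where "\<And>n. f n \<in> D" "f \<longlonglongrightarrow> x" "\<And>n. g n \<in> D" "g \<longlonglongrightarrow> y"
      unfolding closure_sequential by blast
    then show "x + y \<in> closure D"
      unfolding closure_sequential using add tendsto_add
      by (intro exI[where x = "\<lambda>n. f n + g n"]) blast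
  next
    fix c :: real and x assume "x \<in> closure D"
    then obtain f where f: "\<And>n. f n \<in> D" "f \<longlonglongrightarrow> x"
      unfolding closure_sequential by blast
    have "c \<in> closure \<rat>"
      by (simp add: Rats_closure_real)
    then obtain r where r: "\<And>n. r n \<in> \<rat>" "r \<longlonglongrightarrow> c"
      unfolding closure_sequential by blast
    have "r n *\<^sub>R f n \<in> D" for n
      using r(1)[of n] scale[OF f(1)[of n]] by (auto elim!: Rats_cases)
    moreover have "(\<lambda>n. r n *\<^sub>R f n) \<longlonglongrightarrow> c *\<^sub>R x"
      using r(2) f(2) by (rule tendsto_scaleR)
    ultimately show "c *\<^sub>R x \<in> closure D"
      unfolding closure_sequential by (intro exI[where x = "\<lambda>n. r n *\<^sub>R f n"]) simp
  qed
  then show "closure D \<in> separable_subspaces"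
    unfolding separable_subspaces_def using \<open>countable D\<close> closure_subset by blast
  have "b \<in> D" if "b \<in> B" for b
    unfolding D_def using that by (intro image_eqI[where x = "[(1, b)]"]) auto
  then show "B \<subseteq> closure D"
    using closure_subset by blast
qed

lemma closed_cofinal_separable:
  assumes "closed_cofinal \<F>" "F \<in> \<F>"
  obtains D where "countable D" "D \<subseteq> F" "F \<subseteq> closure D" "subspace F" "closed F"
  using assms unfolding closed_cofinal_def separable_subspaces_def by blast

lemma closed_cofinal_countable:
  assumes "closed_cofinal \<F>" "countable B"
  obtains F where "F \<in> \<F>" "B \<subseteq> F"
  using countable_subset_separable[OF assms(2)] assms(1)
  unfolding closed_cofinal_def by (metis subset_trans)

text \<open>
  A Loewenheim-Skolem argument: \<open>G\<close>, \<open>H\<close> and \<open>S\<close> play the role of Skolem functions.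
\<close>

lemma closed_cofinal_closing:
  fixes \<F> :: "'e::real_normed_vector set set" and G :: "'b \<Rightarrow> 'b \<Rightarrow> 'e set"
    and H :: "'e \<Rightarrow> 'b \<Rightarrow> 'b set" and S :: "'b \<Rightarrow> 'b \<Rightarrow> 'b set"
  assumes cc: "closed_cofinal \<F>" and N0: "countable N0"
    and G: "\<And>x y. countable (G x y)" and H: "\<And>d x. countable (H d x)"
    and S: "\<And>x y. countable (S x y)"
  obtains F D N where "F \<in> \<F>" "D \<subseteq> F" "F \<subseteq> closure D" "countable N" "N0 \<subseteq> N"
    "\<And>x y. x \<in> N \<Longrightarrow> y \<in> N \<Longrightarrow> G x y \<subseteq> F"
    "\<And>x y. x \<in> N \<Longrightarrow> y \<in> N \<Longrightarrow> S x y \<subseteq> N"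
    "\<And>d x. d \<in> D \<Longrightarrow> x \<in> N \<Longrightarrow> H d x \<subseteq> N"
proof -
  \<comment> \<open>A stage is a member of the family, a countable dense subset of it and a
    countable set of points; \<open>step\<close> lets the next stage meet every demand raised by the
    current one.\<close>
  define good where "good = (\<lambda>(F, D, N). F \<in> \<F> \<and> countable D \<and> D \<subseteq> F \<and> F \<subseteq> closure D
    \<and> countable N \<and> N0 \<subseteq> N)"
  define step where "step = (\<lambda>(F, D, N) (F', D', N'). F \<subseteq> F' \<and> D \<subseteq> D' \<and> N \<subseteq> N'
    \<and> (\<forall>x\<in>N. \<forall>y\<in>N. G x y \<subseteq> F' \<and> S x y \<subseteq> N') \<and> (\<forall>d\<in>D. \<forall>x\<in>N. H d x \<subseteq> N'))"
  have "\<exists>s. good s"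
  proof -
    obtain F where "F \<in> \<F>"
      using closed_cofinal_countable[OF cc, of "{}"] by auto
    moreover obtain D where "countable D" "D \<subseteq> F" "F \<subseteq> closure D"
      using closed_cofinal_separable[OF cc \<open>F \<in> \<F>\<close>] by metis
    ultimately show ?thesis
      using N0 by (intro exI[where x = "(F, D, N0)"]) (simp add: good_def)
  qed
  moreover have "\<exists>t. good t \<and> step s t" if s: "good s" for s
  proof -
    obtain F D N where s_eq: "s = (F, D, N)"
      by (cases s)
    have FDN: "F \<in> \<F>" "countable D" "D \<subseteq> F" "F \<subseteq> closure D" "countable N" "N0 \<subseteq> N"
      using s by (auto simp: s_eq good_def)
    define N' where "N' = N \<union> (\<Union>x\<in>N. \<Union>y\<in>N. S x y) \<union> (\<Union>d\<in>D. \<Union>x\<in>N. H d x)"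
    have "countable N'"
      unfolding N'_def using FDN S H by auto
    \<comment> \<open>Only the countable set \<open>D\<close> can be handed to cofinality;
      \<open>F'\<close>, being closed, then contains all of \<open>F\<close>.\<close>
    have "countable (D \<union> (\<Union>x\<in>N. \<Union>y\<in>N. G x y))"
      using FDN G by auto
    then obtain F' where F': "F' \<in> \<F>" "D \<union> (\<Union>x\<in>N. \<Union>y\<in>N. G x y) \<subseteq> F'"
      by (rule closed_cofinal_countable[OF cc])
    obtain D' where D': "countable D'" "D' \<subseteq> F'" "F' \<subseteq> closure D'" "closed F'"
      using closed_cofinal_separable[OF cc F'(1)] by metis
    have "F \<subseteq> F'"
      using FDN(4) F'(2) D'(4) closure_minimal[of D F'] by auto
    have "F' \<subseteq> closure (D \<union> D')"
      using D'(3) closure_mono[of D' "D \<union> D'"] by auto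
    then have "good (F', D \<union> D', N')"
      using F' D' FDN \<open>countable N'\<close> by (auto simp: good_def N'_def)
    moreover have "step s (F', D \<union> D', N')"
      using F' \<open>F \<subseteq> F'\<close> by (auto simp: s_eq step_def N'_def UN_subset_iff)
    ultimately show ?thesis
      by blast
  qed
  ultimately obtain s where s: "\<And>n. good (s n)" "\<And>n. step (s n) (s (Suc n))"
    using dependent_nat_choice[of "\<lambda>_. good" "\<lambda>_. step"] by blast
  define F where "F = (\<lambda>n. fst (s n))"
  define D where "D = (\<lambda>n. fst (snd (s n)))"
  define N where "N = (\<lambda>n. snd (snd (s n)))"
  have g: "F n \<in> \<F>" "countable (D n)" "D n \<subseteq> F n" "F n \<subseteq> closure (D n)" "countable (N n)" "N0 \<subseteq> N n" for n
    using s(1)[of n] by (auto simp: good_def F_def D_def N_def split: prod.splits)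
  have st: "F n \<subseteq> F (Suc n)" "D n \<subseteq> D (Suc n)" "N n \<subseteq> N (Suc n)"
      "\<And>x y. x \<in> N n \<Longrightarrow> y \<in> N n \<Longrightarrow> G x y \<subseteq> F (Suc n) \<and> S x y \<subseteq> N (Suc n)"
      "\<And>d x. d \<in> D n \<Longrightarrow> x \<in> N n \<Longrightarrow> H d x \<subseteq> N (Suc n)" for n
    using s(2)[of n] by (auto simp: step_def F_def D_def N_def split: prod.splits)
  have mono: "mono D" "mono N"
    using st by (auto intro: mono_iff_le_Suc[THEN iffD2])
  have common: "\<exists>n. x \<in> N n \<and> y \<in> N n" if xy: "x \<in> \<Union>(range N)" "y \<in> \<Union>(range N)" for x y
  proof -
    from xy obtain i j where "x \<in> N i" "y \<in> N j"
      by auto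
    then show ?thesis
      using monoD[OF mono(2), of i "max i j"] monoD[OF mono(2), of j "max i j"] by auto
  qed
  have common': "\<exists>n. d \<in> D n \<and> x \<in> N n" if dx: "d \<in> \<Union>(range D)" "x \<in> \<Union>(range N)" for d x
  proof -
    from dx obtain i j where "d \<in> D i" "x \<in> N j"
      by auto
    then show ?thesis
      using monoD[OF mono(1), of i "max i j"] monoD[OF mono(2), of j "max i j"] by auto
  qed
  let ?F = "closure (span (\<Union>n. F n))"
  have F: "?F \<in> \<F>"
    using cc g(1) st(1) unfolding closed_cofinal_def by blast
  have sub: "F n \<subseteq> ?F" for n
    using span_superset[of "\<Union>(range F)"] closure_subset[of "span (\<Union>(range F))"] by blast
  \<comment> \<open>An increasing union of subspaces is its own span, so the supremum is the closure
    of the union, and the union of the sets \<open>D n\<close> is dense in it.\<close>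
  have "subspace (\<Union>n. F n)"
  proof -
    have sF: "subspace (F n)" for n
      using closed_cofinal_separable[OF cc g(1)] by metis
    have monoF: "F i \<subseteq> F j" if "i \<le> j" for i j
      using lift_Suc_mono_le[of F, OF st(1) that] .
    show ?thesis
    proof (rule subspaceI)
      fix x y assume "x \<in> (\<Union>n. F n)" "y \<in> (\<Union>n. F n)"
      then obtain i j where "x \<in> F i" "y \<in> F j"
        by auto
      then have "x \<in> F (max i j)" "y \<in> F (max i j)"
        using monoF[of i "max i j"] monoF[of j "max i j"] by auto
      then show "x + y \<in> (\<Union>n. F n)"
        using subspace_add[OF sF] by blast
    qed (use subspace_0[OF sF] subspace_scale[OF sF] in blast)+
  qed
  then have span: "span (\<Union>n. F n) = (\<Union>n. F n)"
    by (rule span_eq_iff[THEN iffD2])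
  have "F n \<subseteq> closure (\<Union>n. D n)" for n
    using g(4)[of n] closure_mono[of "D n" "\<Union>(range D)"] by auto
  then have dense: "?F \<subseteq> closure (\<Union>n. D n)"
    unfolding span by (intro closure_minimal) auto
  show ?thesis
  proof (rule that[of ?F "\<Union>n. D n" "\<Union>n. N n"])
    show "(\<Union>n. D n) \<subseteq> ?F"
      using g(3) sub by blast
    show "G x y \<subseteq> ?F" if "x \<in> (\<Union>n. N n)" "y \<in> (\<Union>n. N n)" for x y
      using common[OF that] st(4) sub by blast
    show "S x y \<subseteq> (\<Union>n. N n)" if "x \<in> (\<Union>n. N n)" "y \<in> (\<Union>n. N n)" for x y
      using common[OF that] st(4) by blast
    show "H d x \<subseteq> (\<Union>n. N n)" if "d \<in> (\<Union>n. D n)" "x \<in> (\<Union>n. N n)" for d x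
      using common'[OF that] st(5) by blast
    show "N0 \<subseteq> (\<Union>n. N n)"
      using g(6) by blast
  qed (use F dense g in auto)
qed

lemma evaluation_dist_le:
  fixes f g :: "'a::topological_space \<Rightarrow>\<^sub>C real"
  shows "\<bar>f x - g x\<bar> \<le> dist f g"
  using dist_bounded[of f x g] by (simp add: dist_real_def)

text \<open>Evaluation at a point is 1-Lipschitz for the supremum norm. Hence whether
  \<open>F\<close> separates two points can be tested on a countable dense subset.\<close>

lemma eq_on_dense:
  fixes D :: "('a::topological_space \<Rightarrow>\<^sub>C real) set"
  assumes "F \<subseteq> closure D" "f \<in> F" and eq: "\<And>d. d \<in> D \<Longrightarrow> d x = d y"
  shows "f x = f y"
proof (rule ccontr)
  assume "f x \<noteq> f y"
  then have "0 < \<bar>f x - f y\<bar> / 2"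
    by simp
  then obtain d where d: "d \<in> D" "dist d f < \<bar>f x - f y\<bar> / 2"
    using assms(1,2) closure_approachableD by (metis dist_commute subsetD)
  then show False
    using eq[OF d(1)] evaluation_dist_le[of d x f] evaluation_dist_le[of d y f]
    by (auto simp: abs_real_def split: if_splits)
qed

subsection \<open>Continuous functions on a compact line\<close>

text \<open>A compact Hausdorff space is normal, and Urysohn's lemma applies to the two disjoint
  closed rays.\<close>

lemma step_function:
  fixes s t :: "'a::linorder_topology"
  assumes "compact (UNIV :: 'a set)" "s < t"
  obtains u :: "'a \<Rightarrow>\<^sub>C real" where "\<And>x. 0 \<le> u x \<and> u x \<le> 1"
    "\<And>x. x \<le> s \<Longrightarrow> u x = 0" "\<And>x. t \<le> x \<Longrightarrow> u x = 1"
proof -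
  have "Hausdorff_space (euclidean :: 'a topology)"
    unfolding Hausdorff_space_def disjnt_def by simp (metis hausdorff)
  then have normal: "normal_space (euclidean :: 'a topology)"
    using assms(1) by (intro compact_Hausdorff_or_regular_imp_normal_space)
      (auto simp: compact_space_def)
  have disj: "disjnt {..s} {t..}"
    using assms(2) by (auto simp: disjnt_def)
  obtain f where f: "continuous_map euclidean (top_of_set {0..1::real}) f"
      "f ` {..s} \<subseteq> {0}" "f ` {t..} \<subseteq> {1}"
    by (rule Urysohn_lemma[OF normal _ _ disj, of 0 1]) auto
  have cont: "continuous_on UNIV f" and range: "f x \<in> {0..1}" for x
    using f(1) by (auto simp: continuous_map_in_subtopology image_subset_iff)
  have "f \<in> bcontfun"
    using cont range by (intro bcontfun_normI[where b = 1]) auto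
  then have "apply_bcontfun (Bcontfun f) = f"
    by (simp add: Bcontfun_inverse)
  then show ?thesis
    using that[of "Bcontfun f"] range f(2,3) by (auto simp: image_subset_iff)
qed

lemma step_functions:
  assumes "compact (UNIV :: 'a::linorder_topology set)"
  shows "\<exists>u :: 'a \<Rightarrow> 'a \<Rightarrow> 'a \<Rightarrow>\<^sub>C real. \<forall>x y. x < y \<longrightarrow>
    (\<forall>z. 0 \<le> u x y z \<and> u x y z \<le> 1) \<and> (\<forall>z\<le>x. u x y z = 0) \<and> (\<forall>z\<ge>y. u x y z = 1)"
proof -
  have "\<forall>x y. \<exists>u :: 'a \<Rightarrow>\<^sub>C real. x < y \<longrightarrow>
      (\<forall>z. 0 \<le> u z \<and> u z \<le> 1) \<and> (\<forall>z\<le>x. u z = 0) \<and> (\<forall>z\<ge>y. u z = 1)"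
    using step_function[OF assms] by metis
  then show ?thesis
    by metis
qed

section \<open>One-sided limits of a set of points\<close>

text \<open>The first conjunct excludes the least point of the line, where the second one holds
  vacuously.\<close>

definition left_limit_of :: "'a::linorder \<Rightarrow> 'a set \<Rightarrow> bool" where
  "left_limit_of x N \<longleftrightarrow> (\<exists>c. c < x) \<and> (\<forall>c<x. \<exists>s\<in>N. c < s \<and> s < x)"

definition right_limit_of :: "'a::linorder \<Rightarrow> 'a set \<Rightarrow> bool" where
  "right_limit_of x N \<longleftrightarrow> (\<exists>c. x < c) \<and> (\<forall>c>x. \<exists>s\<in>N. x < s \<and> s < c)"

lemma left_limit_ofD:
  assumes "left_limit_of x N"
  shows "\<exists>s\<in>N. s < x" "c < x \<Longrightarrow> \<exists>s\<in>N. c < s \<and> s < x"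
  using assms unfolding left_limit_of_def by blast+

lemma right_limit_ofD:
  assumes "right_limit_of x N"
  shows "\<exists>s\<in>N. x < s" "x < c \<Longrightarrow> \<exists>s\<in>N. x < s \<and> s < c"
  using assms unfolding right_limit_of_def by blast+

lemma left_limit_near:
  fixes f :: "'a::linorder_topology \<Rightarrow>\<^sub>C real"
  assumes "left_limit_of x N" "0 < e"
  obtains s where "s \<in> N" "s < x" "\<And>y. s \<le> y \<Longrightarrow> y \<le> x \<Longrightarrow> \<bar>f y - f x\<bar> < e"
proof -
  let ?U = "apply_bcontfun f -` ball (f x) e"
  have "open ?U" "x \<in> ?U"
    using \<open>0 < e\<close> by (auto intro!: open_vimage)
  moreover obtain c where "c < x"
    using assms(1) unfolding left_limit_of_def by blast
  ultimately obtain b where b: "b < x" "{b<..x} \<subseteq> ?U"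
    using open_left by blast
  then obtain s where "s \<in> N" "b < s" "s < x"
    using left_limit_ofD(2)[OF assms(1)] by blast
  then show ?thesis
    using b(2) by (intro that[of s]) (auto simp: dist_real_def subset_eq abs_minus_commute)
qed

lemma right_limit_near:
  fixes f :: "'a::linorder_topology \<Rightarrow>\<^sub>C real"
  assumes "right_limit_of x N" "0 < e"
  obtains s where "s \<in> N" "x < s" "\<And>y. x \<le> y \<Longrightarrow> y \<le> s \<Longrightarrow> \<bar>f y - f x\<bar> < e"
proof -
  let ?U = "apply_bcontfun f -` ball (f x) e"
  have "open ?U" "x \<in> ?U"
    using \<open>0 < e\<close> by (auto intro!: open_vimage)
  moreover obtain c where "x < c"
    using assms(1) unfolding right_limit_of_def by blast
  ultimately obtain b where b: "x < b" "{x..<b} \<subseteq> ?U"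
    using open_right by blast
  then obtain s where "s \<in> N" "x < s" "s < b"
    using right_limit_ofD(2)[OF assms(1)] by blast
  then show ?thesis
    using b(2) by (intro that[of s]) (auto simp: dist_real_def subset_eq abs_minus_commute)
qed

subsection \<open>Norms of projections\<close>

text \<open>A projection onto \<open>F\<close> fixes these functions, so they can correct a test
  function at a known cost in its image.\<close>

definition contains_steps :: "('a::linorder_topology \<Rightarrow>\<^sub>C real) set \<Rightarrow> 'a set \<Rightarrow> bool" where
  "contains_steps F N \<longleftrightarrow> (\<forall>s\<in>N. \<forall>t\<in>N. s < t \<longrightarrow>
     (\<exists>u\<in>F. (\<forall>x. 0 \<le> u x \<and> u x \<le> 1) \<and> (\<forall>x\<le>s. u x = 0) \<and> (\<forall>x\<ge>t. u x = 1)))"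

lemma contains_stepsE:
  assumes "contains_steps F N" "s \<in> N" "t \<in> N" "s < t"
  obtains u where "u \<in> F" "\<And>x. 0 \<le> u x \<and> u x \<le> 1" "\<And>x. x \<le> s \<Longrightarrow> u x = 0" "\<And>x. t \<le> x \<Longrightarrow> u x = 1"
  using assms unfolding contains_steps_def by blast

text \<open>Seen through \<open>F\<close>, \<open>p\<close> and \<open>q\<close> are a single point
  that \<open>N\<close> approaches from both sides.\<close>

definition gap_of :: "('a::linorder_topology \<Rightarrow>\<^sub>C real) set \<Rightarrow> 'a set \<Rightarrow> 'a \<Rightarrow> 'a \<Rightarrow> bool" where
  "gap_of F N p q \<longleftrightarrow> p < q \<and> (\<forall>f\<in>F. f p = f q) \<and> left_limit_of p N \<and> right_limit_of q N"

lemma projection_fixes: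
  assumes "bounded_projection P" "f \<in> range P"
  shows "P f = f"
  using assms unfolding bounded_projection_def by (metis comp_apply imageE)

text \<open>Take \<open>f\<close> equal to -1 up to \<open>p\<close> and to 1 from \<open>q\<close>
  on. Its image has one common value at \<open>p\<close> and \<open>q\<close>, so on one side it
  misses \<open>f\<close> by at least 1. On that side a step of height 2 from the range keeps the
  test function in the unit ball but pushes its image to modulus almost 2.\<close>

lemma projection_norm_ge_2:
  fixes P :: "('a::linorder_topology \<Rightarrow>\<^sub>C real) \<Rightarrow> ('a \<Rightarrow>\<^sub>C real)"
  assumes comp: "compact (UNIV :: 'a set)" and P: "bounded_projection P"
    and steps: "contains_steps (range P) N" and gap: "gap_of (range P) N p q"
  shows "2 \<le> onorm P"
proof (rule field_le_epsilon)
  fix e :: real assume "0 < e"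
  have lin: "bounded_linear P"
    using P by (simp add: bounded_projection_def)
  have pq: "p < q" "left_limit_of p N" "right_limit_of q N" and eq: "P f p = P f q" for f
    using gap by (auto simp: gap_of_def)
  obtain v :: "'a \<Rightarrow>\<^sub>C real" where v: "\<And>x. 0 \<le> v x \<and> v x \<le> 1"
      "\<And>x. x \<le> p \<Longrightarrow> v x = 0" "\<And>x. q \<le> x \<Longrightarrow> v x = 1"
    using step_function[OF comp pq(1)] by metis
  define f where "f = 2 *\<^sub>R v - const_bcontfun 1"
  have f: "f x = 2 * v x - 1" for x
    by (simp add: f_def)
  have bound: "\<bar>P g x\<bar> \<le> onorm P" if "\<And>y. \<bar>g y\<bar> \<le> 1" for g :: "'a \<Rightarrow>\<^sub>C real" and x
  proof -
    have "\<bar>P g x\<bar> \<le> norm (P g)"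
      using norm_bounded[of "P g" x] by simp
    also have "\<dots> \<le> onorm P * norm g"
      by (rule onorm[OF lin])
    also have "\<dots> \<le> onorm P * 1"
      using that norm_bound[of g 1] onorm_pos_le[OF lin] by (intro mult_left_mono) auto
    finally show ?thesis
      by simp
  qed
  show "2 \<le> onorm P + e"
  \<comment> \<open>For a value at most 0 the correction acts to the right of \<open>q\<close>,
    where \<open>f\<close> is 1: \<open>f - 2u\<close> descends from 1 to -1, while its image at
    \<open>t\<close> is at most about -2.\<close>
  proof (cases "P f q \<le> 0")
    case True
    obtain t where t: "t \<in> N" "q < t" "\<And>y. q \<le> y \<Longrightarrow> y \<le> t \<Longrightarrow> \<bar>P f y - P f q\<bar> < e"
      using right_limit_near[OF pq(3) \<open>0 < e\<close>, of "P f"] by metis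
    obtain s where s: "s \<in> N" "q < s" "s < t"
      using right_limit_ofD(2)[OF pq(3) t(2)] by blast
    obtain u where u: "u \<in> range P" "\<And>x. 0 \<le> u x \<and> u x \<le> 1" "\<And>x. x \<le> s \<Longrightarrow> u x = 0"
        "\<And>x. t \<le> x \<Longrightarrow> u x = 1"
      using contains_stepsE[OF steps s(1) t(1) s(3)] by metis
    have "\<bar>(f - 2 *\<^sub>R u) y\<bar> \<le> 1" for y
    proof (cases "y \<le> s")
      case True
      then show ?thesis
        using u(3)[OF True] v(1)[of y] by (auto simp: f)
    next
      case False
      then have "v y = 1"
        using s(2) by (intro v(3)) auto
      then show ?thesis
        using u(2)[of y] by (auto simp: f)
    qed
    then have "\<bar>P (f - 2 *\<^sub>R u) t\<bar> \<le> onorm P"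
      by (rule bound)
    moreover have "P (f - 2 *\<^sub>R u) = P f - 2 *\<^sub>R u"
      using projection_fixes[OF P u(1)] linear_diff[OF bounded_linear.linear[OF lin]]
        linear_scale[OF bounded_linear.linear[OF lin]] by simp
    ultimately have "\<bar>P f t - 2\<bar> \<le> onorm P"
      using u(4)[of t] by simp
    then show ?thesis
      using True t(3)[OF less_imp_le[OF t(2)] order_refl]
      by (auto simp: abs_real_def split: if_splits)
  next
    case False
    then have pos: "0 \<le> P f p"
      using eq[of f] by simp
    \<comment> \<open>Now the correction acts to the left of \<open>p\<close>. Adding
      \<open>2u\<close> alone would produce the value 3 beyond \<open>q\<close>, so a second step
      \<open>w\<close> cancels it before \<open>p\<close> is reached.\<close>
    obtain s where s: "s \<in> N" "s < p" "\<And>y. s \<le> y \<Longrightarrow> y \<le> p \<Longrightarrow> \<bar>P f y - P f p\<bar> < e"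
      using left_limit_near[OF pq(2) \<open>0 < e\<close>, of "P f"] by metis
    obtain t where t: "t \<in> N" "s < t" "t < p"
      using left_limit_ofD(2)[OF pq(2) s(2)] by blast
    obtain s' where s': "s' \<in> N" "t < s'" "s' < p"
      using left_limit_ofD(2)[OF pq(2) t(3)] by blast
    obtain t' where t': "t' \<in> N" "s' < t'" "t' < p"
      using left_limit_ofD(2)[OF pq(2) s'(3)] by blast
    obtain u where u: "u \<in> range P" "\<And>x. 0 \<le> u x \<and> u x \<le> 1" "\<And>x. x \<le> s \<Longrightarrow> u x = 0"
        "\<And>x. t \<le> x \<Longrightarrow> u x = 1"
      using contains_stepsE[OF steps s(1) t(1) t(2)] by metis
    obtain w where w: "w \<in> range P" "\<And>x. 0 \<le> w x \<and> w x \<le> 1" "\<And>x. x \<le> s' \<Longrightarrow> w x = 0"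
        "\<And>x. t' \<le> x \<Longrightarrow> w x = 1"
      using contains_stepsE[OF steps s'(1) t'(1) t'(2)] by metis
    have "\<bar>(f + 2 *\<^sub>R (u - w)) y\<bar> \<le> 1" for y
    proof (cases "y \<le> s'")
      case True
      then have "v y = 0" "w y = 0"
        using s'(3) w(3) by (auto intro: v(2))
      then show ?thesis
        using u(2)[of y] by (auto simp: f)
    next
      case False
      then have uy: "u y = 1"
        using s'(2) by (intro u(4)) auto
      show ?thesis
      proof (cases "y \<le> p")
        case True
        then show ?thesis
          using uy v(2)[OF True] w(2)[of y] by (auto simp: f)
      next
        case False
        then have "w y = 1"
          using t'(3) by (intro w(4)) auto
        then show ?thesis
          using uy v(1)[of y] by (auto simp: f)
      qed
    qed
    then have "\<bar>P (f + 2 *\<^sub>R (u - w)) t\<bar> \<le> onorm P"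
      by (rule bound)
    moreover have "P (f + 2 *\<^sub>R (u - w)) = P f + 2 *\<^sub>R (u - w)"
      using projection_fixes[OF P u(1)] projection_fixes[OF P w(1)]
      by (simp add: linear_simps(1-5)[OF lin])
    ultimately have "\<bar>P f t + 2\<bar> \<le> onorm P"
      using u(4)[of t] w(3)[of t] s'(2) by simp
    then show ?thesis
      using pos s(3)[OF less_imp_le[OF t(2)] less_imp_le[OF t(3)]]
      by (auto simp: abs_real_def split: if_splits)
  qed
qed

text \<open>
  Modulo the range of \<open>P\<close> the step functions across finitely many disjoint gaps can be replaced by
  functions with disjoint supports, so every signed sum of their images under \<open>I - P\<close> is bounded
  by \<open>1 + \<parallel>P\<parallel>\<close>.  Each single image has absolute value at least \<open>1/2\<close> at an endpoint of its gap, hence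
  at least \<open>1/3\<close> on a one-sided neighbourhood, in which the next gap is chosen.
\<close>

lemma gap_rank_bounded:
  fixes P :: "('a::linorder_topology \<Rightarrow>\<^sub>C real) \<Rightarrow> ('a \<Rightarrow>\<^sub>C real)" and p q :: "'b \<Rightarrow> 'a"
  assumes comp: "compact (UNIV :: 'a set)" and P: "bounded_projection P"
    and steps: "contains_steps (range P) N"
    and gap: "\<And>i. i \<in> X \<Longrightarrow> gap_of (range P) N (p i) (q i)"
    and disj: "\<And>i j. i \<in> X \<Longrightarrow> j \<in> X \<Longrightarrow> i \<noteq> j \<Longrightarrow> q i < p j \<or> q j < p i"
    and right: "\<And>n i c. i \<in> X \<Longrightarrow> Rk (Suc n) i \<Longrightarrow> q i < c \<Longrightarrow>
      \<exists>j\<in>X. Rk n j \<and> q i < p j \<and> q j < c"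
    and left: "\<And>n i c. i \<in> X \<Longrightarrow> Rk (Suc n) i \<Longrightarrow> c < p i \<Longrightarrow>
      \<exists>j\<in>X. Rk n j \<and> c < p j \<and> q j < p i"
    and i: "i \<in> X" "Rk n i"
  shows "real (Suc n) / 3 \<le> 1 + onorm P"
proof -
  have lin: "bounded_linear P"
    using P by (simp add: bounded_projection_def)
  have pq: "p i < q i" "left_limit_of (p i) N" "right_limit_of (q i) N" "P f (p i) = P f (q i)"
    if "i \<in> X" for i f
    using gap[OF that] by (auto simp: gap_of_def)
  have "\<forall>i\<in>X. \<exists>v :: 'a \<Rightarrow>\<^sub>C real. (\<forall>x. 0 \<le> v x \<and> v x \<le> 1) \<and> (\<forall>x\<le>p i. v x = 0) \<and> (\<forall>x\<ge>q i. v x = 1)"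
    using step_function[OF comp pq(1)] by metis
  then obtain v :: "'b \<Rightarrow> 'a \<Rightarrow>\<^sub>C real" where v: "\<And>i x. i \<in> X \<Longrightarrow> 0 \<le> v i x \<and> v i x \<le> 1"
      "\<And>i x. i \<in> X \<Longrightarrow> x \<le> p i \<Longrightarrow> v i x = 0" "\<And>i x. i \<in> X \<Longrightarrow> q i \<le> x \<Longrightarrow> v i x = 1"
    by metis
  define g where "g i = v i - P (v i)" for i
  \<comment> \<open>\<open>v i\<close> jumps by 1 across the gap and \<open>P (v i)\<close> does not
    jump, so two numbers with difference 1 remain.\<close>
  have half: "1 / 2 \<le> \<bar>g i (q i)\<bar> \<or> 1 / 2 \<le> \<bar>g i (p i)\<bar>" if "i \<in> X" for i
  proof -
    have "g i (q i) - g i (p i) = 1"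
      using v(2,3)[OF that order_refl] pq(4)[OF that] by (simp add: g_def)
    then show ?thesis
      by arith
  qed
  \<comment> \<open>The bounds \<open>l\<close> and \<open>r\<close> strengthen the induction: they
    confine all later gaps and the final point \<open>t\<close> to the neighbourhood where the
    earlier images are still large.\<close>
  have nested: "\<exists>S t. S \<subseteq> X \<and> finite S \<and> card S = Suc n \<and> (\<forall>j\<in>S. l < p j \<and> q j < r) \<and>
      l < t \<and> t < r \<and> (\<forall>j\<in>S. 1 / 3 \<le> \<bar>g j t\<bar>)"
    if "i \<in> X" "Rk n i" "l < p i" "q i < r" for n i l r
    using that
  proof (induction n arbitrary: i l r)
    case 0
    let ?t = "if 1 / 2 \<le> \<bar>g i (q i)\<bar> then q i else p i"
    have "1 / 3 \<le> \<bar>g i ?t\<bar>" "l < ?t" "?t < r"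
      using half[of i] 0 pq(1)[of i] by auto
    then show ?case
      using 0 by (intro exI[where x = "{i}"] exI[where x = ?t]) auto
  next
    case (Suc n)
    have extend: ?case if j: "j \<in> X" "Rk n j" "l' < p j" "q j < r'" and lr: "l \<le> l'" "r' \<le> r"
      and out: "q i \<le> l' \<or> r' \<le> p i"
      and big: "\<And>t. l' < t \<Longrightarrow> t < r' \<Longrightarrow> 1 / 3 \<le> \<bar>g i t\<bar>" for j l' r'
    proof -
      obtain S t where S: "S \<subseteq> X" "finite S" "card S = Suc n" "\<And>j. j \<in> S \<Longrightarrow> l' < p j \<and> q j < r'"
          "l' < t" "t < r'" "\<And>j. j \<in> S \<Longrightarrow> 1 / 3 \<le> \<bar>g j t\<bar>"
        using Suc.IH[OF j] by blast
      \<comment> \<open>By \<open>out\<close> the gap of \<open>i\<close> lies outside the interval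
        that holds the gaps of \<open>S\<close>, so the count really grows.\<close>
      have "i \<notin> S"
        using S(4)[of i] out pq(1)[OF Suc.prems(1)] by force
      have "l < p k \<and> q k < r" if "k \<in> insert i S" for k
        using that S(4)[of k] Suc.prems(3,4) lr by auto
      moreover have "l < t" "t < r"
        using S(5,6) lr by auto
      moreover have "card (insert i S) = Suc (Suc n)"
        using S(2,3) \<open>i \<notin> S\<close> by simp
      moreover have "1 / 3 \<le> \<bar>g k t\<bar>" if "k \<in> insert i S" for k
        using that S(7)[of k] big[OF S(5,6)] by auto
      ultimately show ?thesis
        using S(1,2) Suc.prems(1) by (intro exI[where x = "insert i S"] exI[where x = t]) auto
    qed
    note i = Suc.prems(1)
    from half[OF i] show ?case
    proof
      assume *: "1 / 2 \<le> \<bar>g i (q i)\<bar>"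
      \<comment> \<open>The tolerance 1/6 is what separates 1/2 at the endpoint from the required
        1/3.\<close>
      obtain s where s: "q i < s" "\<And>y. q i \<le> y \<Longrightarrow> y \<le> s \<Longrightarrow> \<bar>g i y - g i (q i)\<bar> < 1 / 6"
        using right_limit_near[OF pq(3)[OF i], of "1 / 6" "g i"] by auto
      obtain j where j: "j \<in> X" "Rk n j" "q i < p j" "q j < min s r"
        using right[OF i Suc.prems(2), of "min s r"] s(1) Suc.prems(4) by auto
      show ?case
      proof (rule extend[OF j])
        show "1 / 3 \<le> \<bar>g i t\<bar>" if "q i < t" "t < min s r" for t
        proof -
          have "\<bar>g i t - g i (q i)\<bar> < 1 / 6"
            using that by (intro s(2)) auto
          with * show ?thesis
            by arith
        qed
      qed (use Suc.prems(3) pq(1)[OF i] in auto)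
    next
      assume *: "1 / 2 \<le> \<bar>g i (p i)\<bar>"
      obtain s where s: "s < p i" "\<And>y. s \<le> y \<Longrightarrow> y \<le> p i \<Longrightarrow> \<bar>g i y - g i (p i)\<bar> < 1 / 6"
        using left_limit_near[OF pq(2)[OF i], of "1 / 6" "g i"] by auto
      obtain j where j: "j \<in> X" "Rk n j" "max s l < p j" "q j < p i"
        using left[OF i Suc.prems(2), of "max s l"] s(1) Suc.prems(3) by auto
      show ?case
      proof (rule extend[OF j])
        show "1 / 3 \<le> \<bar>g i t\<bar>" if "max s l < t" "t < p i" for t
        proof -
          have "\<bar>g i t - g i (p i)\<bar> < 1 / 6"
            using that by (intro s(2)) auto
          with * show ?thesis
            by arith
        qed
      qed (use Suc.prems(4) pq(1)[OF i] in auto)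
    qed
  qed
  have bound: "(\<Sum>j\<in>S. \<bar>g j t\<bar>) \<le> 1 + onorm P" if S: "S \<subseteq> X" "finite S" for S t
  proof -
    \<comment> \<open>A function of the range that rises from 0 to 1 between the gap of
      \<open>j\<close> and the next gap of \<open>S\<close> to its right. The rightmost gap has no
      successor and takes 0.\<close>
    have "\<exists>w\<in>range P. (\<forall>x. 0 \<le> w x \<and> w x \<le> 1) \<and> (\<forall>x\<le>q j. w x = 0) \<and>
        (\<forall>k\<in>S. q j < p k \<longrightarrow> (\<forall>x\<ge>p k. w x = 1))" if j: "j \<in> S" for j
    proof (cases "{k \<in> S. q j < p k} = {}")
      case True
      have "0 \<in> range P"
        using linear_0[OF bounded_linear.linear[OF lin]] by (metis rangeI)
      then show ?thesis
        using True by (intro bexI[where x = 0]) auto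
    next
      case False
      define m where "m = Min (p ` {k \<in> S. q j < p k})"
      have "m \<in> p ` {k \<in> S. q j < p k}"
        unfolding m_def using False S(2) by (intro Min_in) auto
      then have "q j < m"
        by auto
      have m: "m \<le> p k" if "k \<in> S" "q j < p k" for k
        unfolding m_def using S(2) that by (intro Min_le) auto
      have lim: "right_limit_of (q j) N"
        using j S(1) pq(3) by blast
      obtain s where s: "s \<in> N" "q j < s" "s < m"
        using right_limit_ofD(2)[OF lim \<open>q j < m\<close>] by blast
      obtain s' where s': "s' \<in> N" "q j < s'" "s' < s"
        using right_limit_ofD(2)[OF lim s(2)] by blast
      obtain u where u: "u \<in> range P" "\<And>x. 0 \<le> u x \<and> u x \<le> 1" "\<And>x. x \<le> s' \<Longrightarrow> u x = 0"
          "\<And>x. s \<le> x \<Longrightarrow> u x = 1"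
        using contains_stepsE[OF steps s'(1) s(1) s'(3)] by metis
      have "u x = 0" if "x \<le> q j" for x
        using that s'(2) by (intro u(3)) auto
      moreover have "u x = 1" if "k \<in> S" "q j < p k" "p k \<le> x" for k x
        using that m[of k] s(3) by (intro u(4)) auto
      ultimately show ?thesis
        using u(1,2) by blast
    qed
    then obtain w where w: "\<And>j. j \<in> S \<Longrightarrow> w j \<in> range P"
        "\<And>j x. j \<in> S \<Longrightarrow> 0 \<le> w j x \<and> w j x \<le> 1"
        "\<And>j x. j \<in> S \<Longrightarrow> x \<le> q j \<Longrightarrow> w j x = 0"
        "\<And>j k x. j \<in> S \<Longrightarrow> k \<in> S \<Longrightarrow> q j < p k \<Longrightarrow> p k \<le> x \<Longrightarrow> w j x = 1"
      by metis
    \<comment> \<open>\<open>h j\<close> can be nonzero only between \<open>p j\<close> and the left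
      end of the next gap, whence the disjoint supports.\<close>
    define h where "h j = v j - w j" for j
    have h1: "\<bar>h j x\<bar> \<le> 1" if "j \<in> S" for j x
      using that S(1) v(1)[of j x] w(2)[of j x] by (auto simp: h_def abs_real_def)
    have h0: "h j x = 0 \<or> h k x = 0" if jk: "j \<in> S" "k \<in> S" "q j < p k" for j k x
    proof (cases "x \<le> p k")
      case True
      then have "v k x = 0" "w k x = 0"
        using v(2)[of k x] w(3)[of k x] jk S(1) pq(1)[of k] by auto
      then show ?thesis
        by (simp add: h_def)
    next
      case False
      then have "v j x = 1" "w j x = 1"
        using v(3)[of j x] w(4)[of j k x] jk S(1) by auto
      then show ?thesis
        by (simp add: h_def)
    qed
    have h0': "h j x = 0 \<or> h k x = 0" if "j \<in> S" "k \<in> S" "j \<noteq> k" for j k x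
      using disj[of j k] h0[of j k] h0[of k j] that S(1) by blast
    \<comment> \<open>The signs are chosen for the fixed point \<open>t\<close>, so that the
      contributions to \<open>H - P H\<close> at \<open>t\<close> add up without
      cancellation.\<close>
    define H where "H = (\<Sum>j\<in>S. sgn (g j t) *\<^sub>R h j)"
    have H: "H x = (\<Sum>j\<in>S. sgn (g j t) * h j x)" for x
      unfolding H_def using S(2) by (induction S rule: finite_induct) auto
    have "\<bar>H x\<bar> \<le> 1" for x
    proof (cases "\<exists>j\<in>S. h j x \<noteq> 0")
      case True
      then obtain j where j: "j \<in> S" "h j x \<noteq> 0"
        by blast
      have "h k x = 0" if "k \<in> S - {j}" for k
        using h0'[of j k x] that j by auto
      then have "H x = sgn (g j t) * h j x"
        unfolding H by (subst sum.remove[OF S(2) j(1)]) simp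
      then show ?thesis
        using h1[OF j(1), of x] by (simp add: abs_mult sgn_if)
    qed (simp add: H)
    then have H1: "norm H \<le> 1"
      by (intro norm_bound) simp
    \<comment> \<open>\<open>P\<close> fixes \<open>w j\<close>, so replacing \<open>v j\<close> by
      \<open>h j\<close> leaves the image under \<open>I - P\<close> unchanged.\<close>
    have "P (h j) = P (v j) - w j" if "j \<in> S" for j
      unfolding h_def using projection_fixes[OF P w(1)[OF that]] by (simp add: linear_simps(2)[OF lin])
    then have hg: "h j - P (h j) = g j" if "j \<in> S" for j
      using that by (simp add: g_def h_def)
    have "P H = (\<Sum>j\<in>S. sgn (g j t) *\<^sub>R P (h j))"
      unfolding H_def by (simp add: linear_sum[OF bounded_linear.linear[OF lin]] linear_simps(5)[OF lin])
    then have "H - P H = (\<Sum>j\<in>S. sgn (g j t) *\<^sub>R (h j - P (h j)))"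
      unfolding H_def by (simp add: sum_subtractf scaleR_diff_right)
    also have "\<dots> = (\<Sum>j\<in>S. sgn (g j t) *\<^sub>R g j)"
      by (simp add: hg)
    finally have "H - P H = (\<Sum>j\<in>S. sgn (g j t) *\<^sub>R g j)" .
    moreover have "(\<Sum>j\<in>S. sgn (g j t) *\<^sub>R g j) t = (\<Sum>j\<in>S. \<bar>g j t\<bar>)"
      using S(2) by (induction S rule: finite_induct) (auto simp: sgn_if)
    ultimately have "(\<Sum>j\<in>S. \<bar>g j t\<bar>) \<le> norm (H - P H)"
      using norm_bounded[of "H - P H" t] by simp
    also have "\<dots> \<le> norm H + norm (P H)"
      by (rule norm_triangle_ineq4)
    also have "norm (P H) \<le> onorm P * norm H"
      by (rule onorm[OF lin])
    also have "\<dots> \<le> onorm P * 1"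
      using H1 onorm_pos_le[OF lin] by (rule mult_left_mono)
    finally show ?thesis
      using H1 by simp
  qed
  obtain l r where "l < p i" "q i < r"
    using pq(2,3)[OF i(1)] unfolding left_limit_of_def right_limit_of_def by blast
  then obtain S t where S: "S \<subseteq> X" "finite S" "card S = Suc n" "\<And>j. j \<in> S \<Longrightarrow> 1 / 3 \<le> \<bar>g j t\<bar>"
    using nested[OF i, of l r] by metis
  have "real (Suc n) / 3 = (\<Sum>j\<in>S. 1 / 3)"
    using S(3) by simp
  also have "\<dots> \<le> (\<Sum>j\<in>S. \<bar>g j t\<bar>)"
    using S(4) by (rule sum_mono)
  also have "\<dots> \<le> 1 + onorm P"
    using bound S(1,2) by blast
  finally show ?thesis .
qed

subsection \<open>Gaps at internal points of uncountable character\<close>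

lemma internal_point_limits:
  assumes "internal_point x"
  shows "left_limit_of x UNIV" "right_limit_of x UNIV"
proof -
  have l: "\<exists>y\<in>T. y < x" if T: "open T" "x \<in> T" for T
  proof -
    have "T \<inter> {..x} \<noteq> {x}"
      using assms T by (auto simp: external_point_def isolated_in_def)
    then obtain y where "y \<in> T" "y \<le> x" "y \<noteq> x"
      using T(2) by blast
    then show ?thesis
      by (auto intro: le_neq_trans)
  qed
  have r: "\<exists>y\<in>T. x < y" if T: "open T" "x \<in> T" for T
  proof -
    have "T \<inter> {x..} \<noteq> {x}"
      using assms T by (auto simp: external_point_def isolated_in_def)
    then obtain y where "y \<in> T" "x \<le> y" "y \<noteq> x"
      using T(2) by blast
    then show ?thesis
      by (auto intro: le_neq_trans)
  qed
  show "left_limit_of x UNIV"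
    unfolding left_limit_of_def using l[of UNIV] l[of "{c<..}" for c] by auto
  show "right_limit_of x UNIV"
    unfolding right_limit_of_def using r[of UNIV] r[of "{..<c}" for c] by auto
qed

text \<open>By compactness the closure of the points of \<open>N\<close> below \<open>x\<close> has
  a greatest element \<open>a\<close>. By \<open>dense\<close> these points have no maximum, so
  \<open>a\<close> exceeds them all and is their limit; it may lie strictly below \<open>x\<close>,
  which is how a gap opens.\<close>

lemma sup_of_left_points:
  fixes x :: "'a::linorder_topology"
  assumes "compact (UNIV :: 'a set)" "s0 \<in> N" "s0 < x"
    and dense: "\<And>s. s \<in> N \<Longrightarrow> s < x \<Longrightarrow> \<exists>t\<in>N. s < t \<and> t < x"
  obtains a where "a \<le> x" "left_limit_of a N" "\<And>s. s \<in> N \<Longrightarrow> s < x \<Longrightarrow> s < a"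
proof -
  let ?S = "{s \<in> N. s < x}"
  have "compact (closure ?S)" "closure ?S \<noteq> {}"
    using compact_Int_closed[OF assms(1), of "closure ?S"] assms(2,3) by auto
  then obtain a where a: "a \<in> closure ?S" "\<And>s. s \<in> closure ?S \<Longrightarrow> s \<le> a"
    using compact_attains_sup[of "closure ?S"] by metis
  have below: "s < a" if s: "s \<in> N" "s < x" for s
  proof -
    obtain t where t: "t \<in> N" "s < t" "t < x"
      using dense[OF s] by blast
    then have "t \<le> a"
      using closure_subset[of ?S] by (intro a(2)) blast
    with t(2) show ?thesis
      by simp
  qed
  show ?thesis
  proof (rule that[OF _ _ below])
    show "a \<le> x"
      using a(1) closure_minimal[of ?S "{..x}"] by (auto dest: less_imp_le)
    show "left_limit_of a N"
      unfolding left_limit_of_def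
    proof (intro conjI allI impI)
      show "\<exists>c. c < a"
        using below assms(2,3) by blast
      show "\<exists>s\<in>N. c < s \<and> s < a" if "c < a" for c
      proof -
        have "{c<..} \<inter> ?S \<noteq> {}"
          using a(1) that open_Int_closure_eq_empty[of "{c<..}" ?S] by auto
        then show ?thesis
          using below by auto
      qed
    qed
  qed
qed

lemma inf_of_right_points:
  fixes x :: "'a::linorder_topology"
  assumes "compact (UNIV :: 'a set)" "s0 \<in> N" "x < s0"
    and dense: "\<And>s. s \<in> N \<Longrightarrow> x < s \<Longrightarrow> \<exists>t\<in>N. x < t \<and> t < s"
  obtains b where "x \<le> b" "right_limit_of b N" "\<And>s. s \<in> N \<Longrightarrow> x < s \<Longrightarrow> b < s"
proof -
  let ?S = "{s \<in> N. x < s}"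
  have "compact (closure ?S)" "closure ?S \<noteq> {}"
    using compact_Int_closed[OF assms(1), of "closure ?S"] assms(2,3) by auto
  then obtain b where b: "b \<in> closure ?S" "\<And>s. s \<in> closure ?S \<Longrightarrow> b \<le> s"
    using compact_attains_inf[of "closure ?S"] by metis
  have above: "b < s" if s: "s \<in> N" "x < s" for s
  proof -
    obtain t where t: "t \<in> N" "x < t" "t < s"
      using dense[OF s] by blast
    then have "b \<le> t"
      using closure_subset[of ?S] by (intro b(2)) blast
    with t(3) show ?thesis
      by simp
  qed
  show ?thesis
  proof (rule that[OF _ _ above])
    show "x \<le> b"
      using b(1) closure_minimal[of ?S "{x..}"] by (auto dest: less_imp_le)
    show "right_limit_of b N"
      unfolding right_limit_of_def
    proof (intro conjI allI impI)
      show "\<exists>c. b < c"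
        using above assms(2,3) by blast
      show "\<exists>s\<in>N. b < s \<and> s < c" if "b < c" for c
      proof -
        have "{..<c} \<inter> ?S \<noteq> {}"
          using b(1) that open_Int_closure_eq_empty[of "{..<c}" ?S] by auto
        then show ?thesis
          using above by auto
      qed
    qed
  qed
qed

text \<open>Intervals around \<open>x\<close> with endpoints in \<open>N\<close> form a countable
  neighbourhood base. In the contrapositive, a point of uncountable character cannot coincide with
  both of its one-sided limits from \<open>N\<close>.\<close>

lemma countable_character_two_sided_limit:
  fixes x :: "'a::linorder_topology"
  assumes "countable N" "left_limit_of x N" "right_limit_of x N"
  shows "countable_character x"
  unfolding countable_character_def
proof (intro exI conjI)
  let ?B = "(\<lambda>(l, r). {l<..<r}) ` (Set.filter (\<lambda>(l, r). l < x \<and> x < r) (N \<times> N))"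
  show "countable ?B"
    using assms(1) by auto
  show "\<forall>B\<in>?B. x \<in> interior B"
    by (auto simp: interior_open)
  show "\<forall>U. open U \<and> x \<in> U \<longrightarrow> (\<exists>B\<in>?B. B \<subseteq> U)"
  proof (intro allI impI)
    fix U assume U: "open U \<and> x \<in> U"
    obtain c d where "c < x" "x < d"
      using assms(2,3) unfolding left_limit_of_def right_limit_of_def by blast
    then obtain l r where lr: "l < x" "{l<..x} \<subseteq> U" "x < r" "{x..<r} \<subseteq> U"
      using open_left[of U x c] open_right[of U x d] U by blast
    obtain s where s: "s \<in> N" "l < s" "s < x"
      using left_limit_ofD(2)[OF assms(2) lr(1)] by blast
    obtain t where t: "t \<in> N" "x < t" "t < r"
      using right_limit_ofD(2)[OF assms(3) lr(3)] by blast
    have "{s<..<t} \<subseteq> U"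
    proof
      fix y assume "y \<in> {s<..<t}"
      then have "y \<in> {l<..x} \<or> y \<in> {x..<r}"
        using s(2) t(3) by auto
      then show "y \<in> U"
        using lr(2,4) by blast
    qed
    then show "\<exists>B\<in>?B. B \<subseteq> U"
      using s t by (intro bexI[where x = "{s<..<t}"]) (auto intro!: image_eqI[where x = "(s, t)"])
  qed
qed

text \<open>\<open>T\<close> collects, for each n, a point from which on \<open>f\<close> stays
  within 1/(n+1) of \<open>f x\<close>. Once \<open>N\<close> contains \<open>T\<close>, the
  supremum of the part of \<open>N\<close> below \<open>x\<close> cannot be told from
  \<open>x\<close> by \<open>f\<close>.\<close>

lemma left_modulus:
  fixes f :: "'a::linorder_topology \<Rightarrow>\<^sub>C real"
  assumes "left_limit_of x UNIV"
  obtains T where "countable T" "T \<noteq> {}" "T \<subseteq> {..<x}"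
    "\<And>a. a \<le> x \<Longrightarrow> \<forall>t\<in>T. t \<le> a \<Longrightarrow> f a = f x"
proof -
  have "\<exists>s<x. \<forall>y. s \<le> y \<longrightarrow> y \<le> x \<longrightarrow> \<bar>f y - f x\<bar> < inverse (real (Suc n))" for n
    using left_limit_near[OF assms, of "inverse (real (Suc n))" f]
    by (metis inverse_positive_iff_positive of_nat_0_less_iff zero_less_Suc)
  then obtain s where s: "\<And>n. s n < x"
      "\<And>n y. s n \<le> y \<Longrightarrow> y \<le> x \<Longrightarrow> \<bar>f y - f x\<bar> < inverse (real (Suc n))"
    by metis
  show ?thesis
  proof (rule that[of "range s"])
    fix a assume a: "a \<le> x" "\<forall>t\<in>range s. t \<le> a"
    show "f a = f x"
    proof (rule ccontr)
      assume "f a \<noteq> f x"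
      then obtain n where "inverse (real (Suc n)) < \<bar>f a - f x\<bar>"
        using reals_Archimedean[of "\<bar>f a - f x\<bar>"] by auto
      then show False
        using s(2)[of n a] a by auto
    qed
  qed (use s(1) in auto)
qed

lemma right_modulus:
  fixes f :: "'a::linorder_topology \<Rightarrow>\<^sub>C real"
  assumes "right_limit_of x UNIV"
  obtains T where "countable T" "T \<noteq> {}" "T \<subseteq> {x<..}"
    "\<And>b. x \<le> b \<Longrightarrow> \<forall>t\<in>T. b \<le> t \<Longrightarrow> f b = f x"
proof -
  have "\<exists>s>x. \<forall>y. x \<le> y \<longrightarrow> y \<le> s \<longrightarrow> \<bar>f y - f x\<bar> < inverse (real (Suc n))" for n
    using right_limit_near[OF assms, of "inverse (real (Suc n))" f]
    by (metis inverse_positive_iff_positive of_nat_0_less_iff zero_less_Suc)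
  then obtain s where s: "\<And>n. x < s n"
      "\<And>n y. x \<le> y \<Longrightarrow> y \<le> s n \<Longrightarrow> \<bar>f y - f x\<bar> < inverse (real (Suc n))"
    by metis
  show ?thesis
  proof (rule that[of "range s"])
    fix b assume b: "x \<le> b" "\<forall>t\<in>range s. b \<le> t"
    show "f b = f x"
    proof (rule ccontr)
      assume "f b \<noteq> f x"
      then obtain n where "inverse (real (Suc n)) < \<bar>f b - f x\<bar>"
        using reals_Archimedean[of "\<bar>f b - f x\<bar>"] by auto
      then show False
        using s(2)[of b n] b by auto
    qed
  qed (use s(1) in auto)
qed

lemma countable_picks:
  fixes A :: "nat \<Rightarrow> 'a set"
  obtains T where "countable T" "\<And>n. A n \<inter> B \<noteq> {} \<Longrightarrow> T \<inter> A n \<inter> B \<noteq> {}"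
proof
  show "countable (range (\<lambda>n. SOME z. z \<in> A n \<inter> B))"
    by simp
  show "range (\<lambda>n. SOME z. z \<in> A n \<inter> B) \<inter> A n \<inter> B \<noteq> {}" if "A n \<inter> B \<noteq> {}" for n
    using some_in_eq[of "A n \<inter> B"] that by blast
qed

text \<open>Closing off is applied to three demands: \<open>F\<close> contains the steps between
  points of \<open>N\<close>, \<open>N\<close> meets each \<open>A n\<close> in every interval of
  \<open>N\<close> where that is possible, and \<open>N\<close> contains the moduli of the functions
  in \<open>D\<close> at its points. The sets \<open>A n\<close> are kept abstract and later
  prescribe internal orders.\<close>

lemma closed_cofinal_gaps:
  fixes \<F> :: "('a::linorder_topology \<Rightarrow>\<^sub>C real) set set" and A :: "nat \<Rightarrow> 'a set"
  assumes comp: "compact (UNIV :: 'a set)" and cc: "closed_cofinal \<F>" and N0: "countable N0"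
    and A0: "A 0 = UNIV"
  obtains F N where "F \<in> \<F>" "countable N" "N0 \<subseteq> N" "contains_steps F N"
    "\<And>x y n. x \<in> N \<Longrightarrow> y \<in> N \<Longrightarrow> A n \<inter> {x<..<y} \<noteq> {} \<Longrightarrow> N \<inter> A n \<inter> {x<..<y} \<noteq> {}"
    "\<And>x. x \<in> N \<Longrightarrow> internal_point x \<Longrightarrow> \<exists>a b. a \<le> x \<and> x \<le> b \<and> (\<forall>f\<in>F. f a = f b) \<and>
      left_limit_of a N \<and> right_limit_of b N \<and>
      (\<forall>s\<in>N. s < x \<longrightarrow> s < a) \<and> (\<forall>s\<in>N. x < s \<longrightarrow> b < s)"
proof -
  obtain u :: "'a \<Rightarrow> 'a \<Rightarrow> 'a \<Rightarrow>\<^sub>C real" where u: "\<And>x y. x < y \<Longrightarrow>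
      (\<forall>z. 0 \<le> u x y z \<and> u x y z \<le> 1) \<and> (\<forall>z\<le>x. u x y z = 0) \<and> (\<forall>z\<ge>y. u x y z = 1)"
    using step_functions[OF comp] by metis
  have "\<forall>(f :: 'a \<Rightarrow>\<^sub>C real) x. \<exists>T. countable T \<and> (left_limit_of x UNIV \<longrightarrow>
      T \<noteq> {} \<and> T \<subseteq> {..<x} \<and> (\<forall>a\<le>x. (\<forall>t\<in>T. t \<le> a) \<longrightarrow> f a = f x))"
    using left_modulus by (metis countable_empty)
  then obtain L where L: "\<And>(f :: 'a \<Rightarrow>\<^sub>C real) x. countable (L f x)"
      "\<And>f x. left_limit_of x UNIV \<Longrightarrow>
      L f x \<noteq> {} \<and> L f x \<subseteq> {..<x} \<and> (\<forall>a\<le>x. (\<forall>t\<in>L f x. t \<le> a) \<longrightarrow> f a = f x)"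
    by metis
  have "\<forall>(f :: 'a \<Rightarrow>\<^sub>C real) x. \<exists>T. countable T \<and> (right_limit_of x UNIV \<longrightarrow>
      T \<noteq> {} \<and> T \<subseteq> {x<..} \<and> (\<forall>b\<ge>x. (\<forall>t\<in>T. b \<le> t) \<longrightarrow> f b = f x))"
    using right_modulus by (metis countable_empty)
  then obtain R where R: "\<And>(f :: 'a \<Rightarrow>\<^sub>C real) x. countable (R f x)"
      "\<And>f x. right_limit_of x UNIV \<Longrightarrow>
      R f x \<noteq> {} \<and> R f x \<subseteq> {x<..} \<and> (\<forall>b\<ge>x. (\<forall>t\<in>R f x. b \<le> t) \<longrightarrow> f b = f x)"
    by metis
  have "\<forall>x y. \<exists>T. countable T \<and> (\<forall>n. A n \<inter> {x<..<y} \<noteq> {} \<longrightarrow> T \<inter> A n \<inter> {x<..<y} \<noteq> {})"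
    using countable_picks by metis
  then obtain S where S: "\<And>x y. countable (S x y)"
      "\<And>x y n. A n \<inter> {x<..<y} \<noteq> {} \<Longrightarrow> S x y \<inter> A n \<inter> {x<..<y} \<noteq> {}"
    by metis
  obtain F D N where FDN: "F \<in> \<F>" "D \<subseteq> F" "F \<subseteq> closure D" "countable N" "N0 \<subseteq> N"
    and G: "\<And>x y. x \<in> N \<Longrightarrow> y \<in> N \<Longrightarrow> {u x y} \<subseteq> F"
    and SN: "\<And>x y. x \<in> N \<Longrightarrow> y \<in> N \<Longrightarrow> S x y \<subseteq> N"
    and HN: "\<And>d x. d \<in> D \<Longrightarrow> x \<in> N \<Longrightarrow> L d x \<union> R d x \<subseteq> N"
    using closed_cofinal_closing[OF cc N0, of "\<lambda>x y. {u x y}" "\<lambda>f x. L f x \<union> R f x" S] L(1) R(1) S(1)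
    by (metis countable_Un countable_empty countable_insert)
  have picks: "N \<inter> A n \<inter> {x<..<y} \<noteq> {}" if "x \<in> N" "y \<in> N" "A n \<inter> {x<..<y} \<noteq> {}" for x y n
    using S(2)[OF that(3)] SN[OF that(1,2)] by blast
  show ?thesis
  proof (rule that[OF FDN(1,4,5) _ picks])
    show "contains_steps F N"
      unfolding contains_steps_def
    proof (intro ballI impI)
      fix s t assume "s \<in> N" "t \<in> N" "s < t"
      then show "\<exists>u\<in>F. (\<forall>x. 0 \<le> u x \<and> u x \<le> 1) \<and> (\<forall>x\<le>s. u x = 0) \<and> (\<forall>x\<ge>t. u x = 1)"
        using u[of s t] G[of s t] by (intro bexI[where x = "u s t"]) auto
    qed
    fix x assume x: "x \<in> N" "internal_point x"
    note lim = internal_point_limits[OF x(2)]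
    \<comment> \<open>Since \<open>A 0\<close> is the whole line, \<open>N\<close> has a point in
      every nonempty interval between two of its points.\<close>
    have between: "\<exists>t\<in>N. s < t \<and> t < r" if "s \<in> N" "r \<in> N" "s < z" "z < r" for s r z
    proof -
      have "z \<in> A 0 \<inter> {s<..<r}"
        using that(3,4) A0 by simp
      then show ?thesis
        using picks[OF that(1,2), of 0] by fastforce
    qed
    \<comment> \<open>At least one function is required, because its moduli are what put points of
      \<open>N\<close> on both sides of \<open>x\<close>.\<close>
    have "D \<noteq> {}"
      using FDN(1,3) closed_cofinal_separable[OF cc FDN(1)] subspace_0
      by (metis closure_empty empty_iff subset_empty)
    then obtain d where d: "d \<in> D"
      by blast
    obtain s0 where s0: "s0 \<in> N" "s0 < x"
      using L(2)[OF lim(1), of d] HN[OF d x(1)] by auto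
    have "\<exists>t\<in>N. s < t \<and> t < x" if "s \<in> N" "s < x" for s
      using left_limit_ofD(2)[OF lim(1) that(2)] between[OF that(1) x(1)] by blast
    then obtain a where a: "a \<le> x" "left_limit_of a N" "\<And>s. s \<in> N \<Longrightarrow> s < x \<Longrightarrow> s < a"
      using sup_of_left_points[OF comp s0] by blast
    obtain t0 where t0: "t0 \<in> N" "x < t0"
      using R(2)[OF lim(2), of d] HN[OF d x(1)] by auto
    have "\<exists>t\<in>N. x < t \<and> t < s" if "s \<in> N" "x < s" for s
      using right_limit_ofD(2)[OF lim(2) that(2)] between[OF x(1) that(1)] by blast
    then obtain b where b: "x \<le> b" "right_limit_of b N" "\<And>s. s \<in> N \<Longrightarrow> x < s \<Longrightarrow> b < s"
      using inf_of_right_points[OF comp t0] by blast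
    \<comment> \<open>The moduli of \<open>d\<close> at \<open>x\<close> lie in \<open>N\<close>,
      hence below \<open>a\<close> and above \<open>b\<close>, so
      \<open>d a = d x = d b\<close>.\<close>
    have "f a = f b" if f: "f \<in> F" for f
    proof (rule eq_on_dense[OF FDN(3) f])
      fix d assume d: "d \<in> D"
      have "t \<le> a" if "t \<in> L d x" for t
        using that L(2)[OF lim(1), of d] HN[OF d x(1)] by (intro less_imp_le a(3)) auto
      moreover have "b \<le> t" if "t \<in> R d x" for t
        using that R(2)[OF lim(2), of d] HN[OF d x(1)] by (intro less_imp_le b(3)) auto
      ultimately show "d a = d b"
        using L(2)[OF lim(1), of d] R(2)[OF lim(2), of d] a(1) b(1) by simp
    qed
    then show "\<exists>a b. a \<le> x \<and> x \<le> b \<and> (\<forall>f\<in>F. f a = f b) \<and>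
        left_limit_of a N \<and> right_limit_of b N \<and>
        (\<forall>s\<in>N. s < x \<longrightarrow> s < a) \<and> (\<forall>s\<in>N. x < s \<longrightarrow> b < s)"
      using a b by blast
  qed
qed

section \<open>Internal order and norms of projections\<close>

text \<open>A single \<open>F\<close> serves all points of \<open>N0\<close> and all orders at once.
  Each point of \<open>N\<close> in \<open>M\<close> opens a gap, and because \<open>N\<close>
  reflects the points of every internal order, \<open>io_ge M\<close> is a rank in the sense of
  \<open>gap_rank_bounded\<close>.\<close>

lemma closed_cofinal_projection_bounds:
  fixes \<F> :: "('a::linorder_topology \<Rightarrow>\<^sub>C real) set set"
  defines "M \<equiv> internal_uncountable_points :: 'a set"
  assumes comp: "compact (UNIV :: 'a set)" and cc: "closed_cofinal \<F>"
    and N0: "countable N0" "N0 \<subseteq> M"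
  obtains F where "F \<in> \<F>"
    "\<And>P x n. bounded_projection P \<Longrightarrow> range P = F \<Longrightarrow> x \<in> N0 \<Longrightarrow> io_ge M n x \<Longrightarrow>
      real (Suc n) / 3 \<le> 1 + onorm P"
    "\<And>P. bounded_projection P \<Longrightarrow> range P = F \<Longrightarrow> N0 \<noteq> {} \<Longrightarrow> 2 \<le> onorm P"
proof -
  \<comment> \<open>Index 0 is reserved for the whole line, so order at least n is found at index
    \<open>Suc n\<close>.\<close>
  define A where "A = case_nat UNIV (\<lambda>n. {z \<in> M. io_ge M n z})"
  have A: "A 0 = UNIV" "A (Suc n) = {z \<in> M. io_ge M n z}" for n
    by (simp_all add: A_def)
  obtain F N where F: "F \<in> \<F>" and N: "countable N" "N0 \<subseteq> N" and steps: "contains_steps F N"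
    and picks: "\<And>x y n. x \<in> N \<Longrightarrow> y \<in> N \<Longrightarrow> A n \<inter> {x<..<y} \<noteq> {} \<Longrightarrow> N \<inter> A n \<inter> {x<..<y} \<noteq> {}"
    and gaps: "\<And>x. x \<in> N \<Longrightarrow> internal_point x \<Longrightarrow> \<exists>a b. a \<le> x \<and> x \<le> b \<and> (\<forall>f\<in>F. f a = f b) \<and>
      left_limit_of a N \<and> right_limit_of b N \<and>
      (\<forall>s\<in>N. s < x \<longrightarrow> s < a) \<and> (\<forall>s\<in>N. x < s \<longrightarrow> b < s)"
    using closed_cofinal_gaps[where A = A, OF comp cc N0(1) A(1)] by blast
  define X where "X = N \<inter> M"
  have M: "internal_point x" "\<not> countable_character x" if "x \<in> M" for x
    using that by (auto simp: M_def internal_uncountable_points_def)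
  have "\<forall>x\<in>X. \<exists>a b. a \<le> x \<and> x \<le> b \<and> gap_of F N a b \<and>
      (\<forall>s\<in>N. s < x \<longrightarrow> s < a) \<and> (\<forall>s\<in>N. x < s \<longrightarrow> b < s)"
  proof
    fix x assume x: "x \<in> X"
    obtain a b where ab: "a \<le> x" "x \<le> b" "\<forall>f\<in>F. f a = f b"
        "left_limit_of a N" "right_limit_of b N"
        "\<forall>s\<in>N. s < x \<longrightarrow> s < a" "\<forall>s\<in>N. x < s \<longrightarrow> b < s"
      using gaps[of x] x M(1)[of x] unfolding X_def by blast
    \<comment> \<open>Otherwise \<open>a = x = b\<close> would be a two-sided limit of the countable
      set \<open>N\<close>.\<close>
    have "a \<noteq> b"
      using countable_character_two_sided_limit[OF N(1)] ab(1,2,4,5) M(2)[of x] x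
      by (auto simp: X_def)
    then have "gap_of F N a b"
      using ab by (auto simp: gap_of_def)
    then show "\<exists>a b. a \<le> x \<and> x \<le> b \<and> gap_of F N a b \<and>
        (\<forall>s\<in>N. s < x \<longrightarrow> s < a) \<and> (\<forall>s\<in>N. x < s \<longrightarrow> b < s)"
      using ab by blast
  qed
  then obtain p q where "\<forall>x\<in>X. p x \<le> x \<and> x \<le> q x \<and> gap_of F N (p x) (q x) \<and>
      (\<forall>s\<in>N. s < x \<longrightarrow> s < p x) \<and> (\<forall>s\<in>N. x < s \<longrightarrow> q x < s)"
    by metis
  then have pq: "\<And>x. x \<in> X \<Longrightarrow> p x \<le> x" "\<And>x. x \<in> X \<Longrightarrow> x \<le> q x"
      "\<And>x. x \<in> X \<Longrightarrow> gap_of F N (p x) (q x)"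
      "\<And>x s. x \<in> X \<Longrightarrow> s \<in> N \<Longrightarrow> s < x \<Longrightarrow> s < p x"
      "\<And>x s. x \<in> X \<Longrightarrow> s \<in> N \<Longrightarrow> x < s \<Longrightarrow> q x < s"
    by blast+
  \<comment> \<open>A point of \<open>N\<close> strictly between \<open>x\<close> and
    \<open>y\<close> separates their gaps.\<close>
  have order: "q x < p y" if xy: "x \<in> X" "y \<in> X" "x < y" for x y
  proof -
    obtain s where "x < s" "s < y"
      using left_limit_ofD(2)[OF internal_point_limits(1)[OF M(1)], of y x] xy by (auto simp: X_def)
    then have "s \<in> A 0 \<inter> {x<..<y}"
      by (simp add: A)
    then obtain z where "z \<in> N" "x < z" "z < y"
      using picks[of x y 0] xy by (fastforce simp: X_def)
    then show ?thesis
      using pq(5)[OF xy(1)] pq(4)[OF xy(2)] by force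
  qed
  show ?thesis
  proof (rule that[OF F])
    fix P :: "('a \<Rightarrow>\<^sub>C real) \<Rightarrow> ('a \<Rightarrow>\<^sub>C real)"
    assume P: "bounded_projection P" "range P = F"
    show "real (Suc n) / 3 \<le> 1 + onorm P" if x: "x \<in> N0" "io_ge M n x" for x n
    proof (rule gap_rank_bounded[where N = N and X = X and p = p and q = q and Rk = "io_ge M" and i = x])
      show "q x < p y \<or> q y < p x" if "x \<in> X" "y \<in> X" "x \<noteq> y" for x y
        using order[of x y] order[of y x] that by (cases x y rule: linorder_cases) auto
      fix n x c assume x: "x \<in> X" "io_ge M (Suc n) x"
      show "\<exists>y\<in>X. io_ge M n y \<and> q x < p y \<and> q y < c" if c: "q x < c"
      proof -
        obtain t where t: "t \<in> N" "q x < t" "t < c"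
          using pq(3)[OF x(1)] right_limit_ofD(2) c unfolding gap_of_def by blast
        have "x < t"
          using pq(2)[OF x(1)] t(2) by simp
        \<comment> \<open>\<open>x\<close> is the infimum of the points of order at least n above
          it, so \<open>t\<close> is not a lower bound of them; reflection then finds such a point
          below \<open>t\<close> inside \<open>N\<close>.\<close>
        have "isGlb UNIV {y \<in> M. y > x \<and> io_ge M n y} x"
          using x(2) by simp
        then have "\<not> t <=* {y \<in> M. y > x \<and> io_ge M n y}"
          using \<open>x < t\<close> by (metis isGlb_le_isLb isLbI UNIV_I leD)
        then have "A (Suc n) \<inter> {x<..<t} \<noteq> {}"
          by (auto simp: setge_def A)
        then have "N \<inter> A (Suc n) \<inter> {x<..<t} \<noteq> {}"
          using x(1) t(1) by (intro picks) (auto simp: X_def)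
        then obtain y where y: "y \<in> X" "io_ge M n y" "x < y" "y < t"
          unfolding A X_def by fastforce
        then show ?thesis
          using order[OF x(1) y(1,3)] pq(5)[OF y(1) t(1) y(4)] t(3) by force
      qed
      show "\<exists>y\<in>X. io_ge M n y \<and> c < p y \<and> q y < p x" if c: "c < p x"
      proof -
        obtain t where t: "t \<in> N" "c < t" "t < p x"
          using pq(3)[OF x(1)] left_limit_ofD(2) c unfolding gap_of_def by blast
        have "t < x"
          using pq(1)[OF x(1)] t(3) by simp
        have "isLub UNIV {y \<in> M. y < x \<and> io_ge M n y} x"
          using x(2) by simp
        then have "\<not> {y \<in> M. y < x \<and> io_ge M n y} *<= t"
          using \<open>t < x\<close> by (metis isLub_le_isUb isUbI UNIV_I leD)
        then have "A (Suc n) \<inter> {t<..<x} \<noteq> {}"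
          by (auto simp: setle_def A)
        then have "N \<inter> A (Suc n) \<inter> {t<..<x} \<noteq> {}"
          using x(1) t(1) by (intro picks) (auto simp: X_def)
        then obtain y where y: "y \<in> X" "io_ge M n y" "t < y" "y < x"
          unfolding A X_def by fastforce
        then show ?thesis
          using order[OF y(1) x(1) y(4)] pq(4)[OF y(1) t(1) y(3)] t(2) by force
      qed
    qed (use comp P steps pq(3) x N N0 in \<open>auto simp: X_def\<close>)
    show "2 \<le> onorm P" if ne: "N0 \<noteq> {}"
    proof -
      obtain x where "x \<in> X"
        using ne N N0 by (auto simp: X_def)
      then show ?thesis
        using projection_norm_ge_2[OF comp P(1)] pq(3) steps P(2) by blast
    qed
  qed
qed

subsection \<open>Closures of countable sets\<close>

text \<open>Evaluation at the functions of \<open>E\<close> is a continuous injection of a compact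
  space into a countable power of the reals, hence an embedding.\<close>

lemma metrizable_if_countably_separated:
  fixes L :: "'a::topological_space set" and E :: "('a \<Rightarrow>\<^sub>C real) set"
  assumes "compact L" "countable E"
    and sep: "\<And>x y. x \<in> L \<Longrightarrow> y \<in> L \<Longrightarrow> x \<noteq> y \<Longrightarrow> \<exists>f\<in>E. f x \<noteq> f y"
  shows "metrizable_space (top_of_set L)"
proof -
  let ?Y = "product_topology (\<lambda>_. euclideanreal) E"
  let ?e = "\<lambda>x. \<lambda>f\<in>E. apply_bcontfun f x"
  have "continuous_map (top_of_set L) ?Y ?e"
    by (auto simp: continuous_map_componentwise)
  moreover have "inj_on ?e L"
  proof (rule inj_onI, rule ccontr)
    fix x y assume xy: "x \<in> L" "y \<in> L" "?e x = ?e y" "x \<noteq> y"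
    then obtain f where "f \<in> E" "f x \<noteq> f y"
      using sep by blast
    then show False
      using fun_cong[OF xy(3), of f] by simp
  qed
  moreover have "compact_space (top_of_set L)"
    using assms(1) by (simp add: compact_space_subtopology)
  moreover have metr: "metrizable_space ?Y"
    using countable_subset[OF _ assms(2)]
    by (auto simp: metrizable_space_product_topology metrizable_space_euclidean)
  ultimately have "embedding_map (top_of_set L) ?Y ?e"
    by (intro continuous_imp_embedding_map metrizable_imp_Hausdorff_space) auto
  then show ?thesis
    using metrizable_space_subtopology[OF metr] homeomorphic_metrizable_space
      embedding_map_imp_homeomorphic_space by blast
qed

lemma countable_subsingleton:
  assumes "\<And>x y. x \<in> S \<Longrightarrow> y \<in> S \<Longrightarrow> x = y"
  shows "countable S"
proof (cases "S = {}")
  case False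
  then obtain y where "S \<subseteq> {y}"
    using assms by blast
  then show ?thesis
    by (rule countable_subset) simp
qed simp

text \<open>\<open>Y\<close> omits the points \<open>y\<close> of \<open>X\<close> for which some
  interval between \<open>y\<close> and a point of \<open>A\<close> holds only countably many points
  of \<open>X\<close>. Only countably many points are lost, so every interval with uncountably many
  points of \<open>X\<close> still meets \<open>Y\<close>.\<close>

lemma two_sided_condensation:
  fixes X A :: "'a::linorder set"
  assumes X: "uncountable X" and A: "countable A"
    and sep: "\<And>x y. x \<in> X \<Longrightarrow> y \<in> X \<Longrightarrow> x < y \<Longrightarrow> \<exists>a\<in>A. x < a \<and> a < y"
  shows "\<exists>Y\<subseteq>X. Y \<noteq> {} \<and> (\<forall>y\<in>Y. \<forall>s\<in>A.
    (s < y \<longrightarrow> (\<exists>z\<in>Y. s < z \<and> z < y)) \<and> (y < s \<longrightarrow> (\<exists>z\<in>Y. y < z \<and> z < s)))"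
proof -
  define l where "l s = {y \<in> X. s < y \<and> countable (X \<inter> {s<..<y})}" for s
  define r where "r s = {y \<in> X. y < s \<and> countable (X \<inter> {y<..<s})}" for s
  have "countable (l s)" for s
  proof -
    \<comment> \<open>A member of \<open>l s\<close> that is not the greatest is separated from a
      larger member by some \<open>a\<close> in \<open>A\<close>, hence lies in one of countably
      many countable sets.\<close>
    have "l s \<subseteq> {y \<in> l s. \<forall>z\<in>l s. z \<le> y} \<union>
        (\<Union>a\<in>{a \<in> A. countable (X \<inter> {s<..<a})}. X \<inter> {s<..<a})"
    proof
      fix y assume y: "y \<in> l s"
      show "y \<in> {y \<in> l s. \<forall>z\<in>l s. z \<le> y} \<union>
        (\<Union>a\<in>{a \<in> A. countable (X \<inter> {s<..<a})}. X \<inter> {s<..<a})"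
      proof (cases "\<forall>z\<in>l s. z \<le> y")
        case False
        then obtain z where z: "z \<in> l s" "y < z"
          by auto
        then obtain a where a: "a \<in> A" "y < a" "a < z"
          using sep[of y z] y by (auto simp: l_def)
        then have sub: "X \<inter> {s<..<a} \<subseteq> X \<inter> {s<..<z}"
          by auto
        have "countable (X \<inter> {s<..<a})"
          using z(1) by (intro countable_subset[OF sub]) (simp add: l_def)
        then show ?thesis
          using y a by (auto simp: l_def)
      qed (use y in simp)
    qed
    moreover have "countable {y \<in> l s. \<forall>z\<in>l s. z \<le> y}"
      by (rule countable_subsingleton) (auto intro: antisym)
    moreover have "countable (\<Union>a\<in>{a \<in> A. countable (X \<inter> {s<..<a})}. X \<inter> {s<..<a})"
      by (rule countable_UN, rule countable_subset[OF _ A]) auto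
    ultimately show ?thesis
      by (meson countable_Un countable_subset)
  qed
  moreover have "countable (r s)" for s
  proof -
    have "r s \<subseteq> {y \<in> r s. \<forall>z\<in>r s. y \<le> z} \<union>
        (\<Union>a\<in>{a \<in> A. countable (X \<inter> {a<..<s})}. X \<inter> {a<..<s})"
    proof
      fix y assume y: "y \<in> r s"
      show "y \<in> {y \<in> r s. \<forall>z\<in>r s. y \<le> z} \<union>
        (\<Union>a\<in>{a \<in> A. countable (X \<inter> {a<..<s})}. X \<inter> {a<..<s})"
      proof (cases "\<forall>z\<in>r s. y \<le> z")
        case False
        then obtain z where z: "z \<in> r s" "z < y"
          by auto
        then obtain a where a: "a \<in> A" "z < a" "a < y"
          using sep[of z y] y by (auto simp: r_def)
        then have sub: "X \<inter> {a<..<s} \<subseteq> X \<inter> {z<..<s}"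
          by auto
        have "countable (X \<inter> {a<..<s})"
          using z(1) by (intro countable_subset[OF sub]) (simp add: r_def)
        then show ?thesis
          using y a by (auto simp: r_def)
      qed (use y in simp)
    qed
    moreover have "countable {y \<in> r s. \<forall>z\<in>r s. y \<le> z}"
      by (rule countable_subsingleton) (auto intro: antisym)
    moreover have "countable (\<Union>a\<in>{a \<in> A. countable (X \<inter> {a<..<s})}. X \<inter> {a<..<s})"
      by (rule countable_UN, rule countable_subset[OF _ A]) auto
    ultimately show ?thesis
      by (meson countable_Un countable_subset)
  qed
  ultimately have thin: "countable (\<Union>s\<in>A. l s \<union> r s)"
    using A by (intro countable_UN countable_Un)
  define Y where "Y = X - (\<Union>s\<in>A. l s \<union> r s)"
  have meets: "Y \<inter> I \<noteq> {}" if "uncountable (X \<inter> I)" for I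
  proof
    assume "Y \<inter> I = {}"
    then have "X \<inter> I \<subseteq> (\<Union>s\<in>A. l s \<union> r s)"
      by (auto simp: Y_def)
    then show False
      using that thin countable_subset by blast
  qed
  show ?thesis
  proof (intro exI[where x = Y] conjI ballI impI)
    show "Y \<subseteq> X"
      by (auto simp: Y_def)
    show "Y \<noteq> {}"
      using meets[of UNIV] X by auto
    fix y s assume "y \<in> Y" "s \<in> A"
    then show "\<exists>z\<in>Y. s < z \<and> z < y" if "s < y"
      using meets[of "{s<..<y}"] that by (auto simp: Y_def l_def)
    show "\<exists>z\<in>Y. y < z \<and> z < s" if "y < s"
      using meets[of "{y<..<s}"] that \<open>y \<in> Y\<close> \<open>s \<in> A\<close> by (auto simp: Y_def r_def)
  qed
qed

text \<open>
  If only countably many jumps of the closure are not separated by a suitable member of the family,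
  then countably many functions separate the points of the closure.  Otherwise condensation yields
  gaps of arbitrarily large rank.
\<close>

lemma complemented_closed_cofinal_imp_metrizable_closure:
  fixes \<F> :: "('a::linorder_topology \<Rightarrow>\<^sub>C real) set set" and A :: "'a set"
  assumes comp: "compact (UNIV :: 'a set)" and cc: "closed_cofinal \<F>"
    and compl: "\<And>F. F \<in> \<F> \<Longrightarrow> complemented F" and A: "countable A"
  shows "metrizable_space (top_of_set (closure A))"
proof -
  define L where "L = closure A"
  have AL: "A \<subseteq> L" and cL: "compact L"
    using closure_subset compact_Int_closed[OF comp, of L] by (auto simp: L_def)
  have meets: "\<exists>a\<in>A. a \<in> U" if "open U" "x \<in> U" "x \<in> L" for U x
    using open_Int_closure_eq_empty[of U A] that by (auto simp: L_def)
  obtain u :: "'a \<Rightarrow> 'a \<Rightarrow> 'a \<Rightarrow>\<^sub>C real" where u: "\<And>x y. x < y \<Longrightarrow>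
      (\<forall>z. 0 \<le> u x y z \<and> u x y z \<le> 1) \<and> (\<forall>z\<le>x. u x y z = 0) \<and> (\<forall>z\<ge>y. u x y z = 1)"
    using step_functions[OF comp] by metis
  have "countable (\<Union>s\<in>A. u s ` A)"
    using A by auto
  then obtain F where F: "F \<in> \<F>" "(\<Union>s\<in>A. u s ` A) \<subseteq> F"
    by (rule closed_cofinal_countable[OF cc])
  have steps: "contains_steps F A"
    unfolding contains_steps_def
  proof (intro ballI impI)
    fix s t assume "s \<in> A" "t \<in> A" "s < t"
    then show "\<exists>u\<in>F. (\<forall>x. 0 \<le> u x \<and> u x \<le> 1) \<and> (\<forall>x\<le>s. u x = 0) \<and> (\<forall>x\<ge>t. u x = 1)"
      using u[of s t] F(2) by (intro bexI[where x = "u s t"]) auto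
  qed
  obtain D where D: "countable D" "F \<subseteq> closure D"
    using closed_cofinal_separable[OF cc F(1)] by metis
  \<comment> \<open>Jumps are pairs of neighbours in \<open>L\<close>. The neighbour on a given side
    is unique, so \<open>\<sigma>\<close> and \<open>\<pi>\<close> name it; elsewhere their values
    are arbitrary.\<close>
  define jump where "jump p q \<longleftrightarrow> p \<in> L \<and> q \<in> L \<and> p < q \<and> L \<inter> {p<..<q} = {}" for p q
  have jump: "q \<le> s" if "jump p q" "s \<in> L" "p < s" for p q s
    using that by (force simp: jump_def)
  have jump': "s \<le> p" if "jump p q" "s \<in> L" "s < q" for p q s
    using that by (force simp: jump_def)
  define \<sigma> where "\<sigma> p = (THE q. jump p q)" for p
  define \<pi> where "\<pi> q = (THE p. jump p q)" for q
  have \<sigma>: "\<sigma> p = q" if "jump p q" for p q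
    unfolding \<sigma>_def
  proof (rule the_equality[where P = "jump p", OF that])
    show "q' = q" if "jump p q'" for q'
      using jump[OF that, of q] jump[OF \<open>jump p q\<close>, of q'] that \<open>jump p q\<close> by (auto simp: jump_def)
  qed
  have \<pi>: "\<pi> q = p" if "jump p q" for p q
    unfolding \<pi>_def
  proof (rule the_equality[where P = "\<lambda>p. jump p q", OF that])
    show "p' = p" if "jump p' q" for p'
      using jump'[OF that, of p] jump'[OF \<open>jump p q\<close>, of p'] that \<open>jump p q\<close> by (auto simp: jump_def)
  qed
  define X where "X = {p \<in> L - A. jump p (\<sigma> p) \<and> \<sigma> p \<notin> A \<and> (\<forall>f\<in>F. f p = f (\<sigma> p))}"
  show ?thesis
  proof (cases "countable X")
    case True
    \<comment> \<open>Besides \<open>A\<close> and \<open>X\<close> this adds the jump partners that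
      steps need as endpoints. Arbitrary values of \<open>\<sigma>\<close> and \<open>\<pi>\<close>
      only enlarge \<open>B\<close> and keep it countable.\<close>
    define B where "B = A \<union> X \<union> \<sigma> ` (A \<union> X) \<union> \<pi> ` A"
    define E where "E = D \<union> (\<Union>s\<in>B. u s ` B)"
    have B: "\<And>z. z \<in> A \<union> X \<Longrightarrow> z \<in> B" "\<And>z. z \<in> A \<union> X \<Longrightarrow> \<sigma> z \<in> B" "\<And>z. z \<in> A \<Longrightarrow> \<pi> z \<in> B"
      by (auto simp: B_def)
    have "countable B"
      using A True by (auto simp: B_def)
    then have E: "countable E"
      using D(1) by (auto simp: E_def)
    have sep: "\<exists>f\<in>E. f x \<noteq> f y" if xy: "x \<in> L" "y \<in> L" "x < y" for x y
    proof -
      have by_step: ?thesis if "s \<in> B" "t \<in> B" "x \<le> s" "s < t" "t \<le> y" for s t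
        using u[OF that(4)] that by (intro bexI[where x = "u s t"]) (auto simp: E_def)
      show ?thesis
      proof (cases "jump x y")
        case True
        then have eq: "\<sigma> x = y" "\<pi> y = x"
          by (simp_all add: \<sigma> \<pi>)
        show ?thesis
        proof (cases "x \<in> A \<or> y \<in> A \<or> x \<in> X")
          case True
          then have "x \<in> B" "y \<in> B"
            using eq B(1)[of x] B(1)[of y] B(2)[of x] B(3)[of y] by auto
          then show ?thesis
            using by_step xy(3) by blast
        next
          case False
          then obtain f where "f \<in> F" "f x \<noteq> f y"
            using \<open>jump x y\<close> eq xy(1) by (auto simp: X_def)
          then obtain d where "d \<in> D" "d x \<noteq> d y"
            using eq_on_dense[OF D(2), of f x y] by blast
          then show ?thesis
            by (auto simp: E_def)
        qed
      next
        \<comment> \<open>Some \<open>a\<close> in \<open>A\<close> lies between \<open>x\<close>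
          and \<open>y\<close>. Either \<open>x\<close> is the left neighbour of \<open>a\<close>,
          hence in \<open>B\<close>, or \<open>A\<close> has a second point between \<open>x\<close>
          and \<open>a\<close>; both give a step that separates.\<close>
        case False
        then obtain z where "z \<in> L" "x < z" "z < y"
          using xy by (auto simp: jump_def)
        then obtain a where a: "a \<in> A" "x < a" "a < y"
          using meets[of "{x<..<y}" z] by auto
        show ?thesis
        proof (cases "jump x a")
          case True
          then have "x \<in> B"
            using B(3)[OF a(1)] \<pi> by simp
          then show ?thesis
            using by_step[of x a] B(1)[of a] a by auto
        next
          case False
          then obtain z where "z \<in> L" "x < z" "z < a"
            using xy a AL by (auto simp: jump_def)
          then obtain a' where "a' \<in> A" "x < a'" "a' < a"
            using meets[of "{x<..<a}" z] by auto
          then show ?thesis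
            using by_step[of a' a] B(1)[of a] B(1)[of a'] a by auto
        qed
      qed
    qed
    have "\<exists>f\<in>E. f x \<noteq> f y" if "x \<in> L" "y \<in> L" "x \<noteq> y" for x y
      using sep that by (metis linorder_neqE)
    then show ?thesis
      using metrizable_if_countably_separated[OF cL E] by (simp add: L_def)
  next
    case False
    \<comment> \<open>Both ends lie in the closure of \<open>A\<close> but outside \<open>A\<close>,
      and no point of \<open>L\<close> is between them, so \<open>A\<close> must accumulate at each
      end from outside the jump.\<close>
    have gap: "gap_of F A x (\<sigma> x)" if x: "x \<in> X" for x
    proof -
      have j: "jump x (\<sigma> x)" and na: "x \<notin> A" "\<sigma> x \<notin> A" and eq: "\<forall>f\<in>F. f x = f (\<sigma> x)"
        using x by (auto simp: X_def)
      have L: "x \<in> L" "\<sigma> x \<in> L" "x < \<sigma> x"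
        using j by (auto simp: jump_def)
      have below: "a < x" if "a \<in> A" "a < \<sigma> x" for a
        using jump'[OF j, of a] that AL na(1) by (metis order_le_less subsetD)
      have above: "\<sigma> x < a" if "a \<in> A" "x < a" for a
        using jump[OF j, of a] that AL na(2) by (metis order_le_less subsetD)
      have "left_limit_of x A"
        unfolding left_limit_of_def
      proof (intro conjI allI impI)
        show "\<exists>c. c < x"
          using meets[of "{..<\<sigma> x}" x] L below by auto
        show "\<exists>s\<in>A. c < s \<and> s < x" if "c < x" for c
          using meets[of "{c<..<\<sigma> x}" x] L below that by auto
      qed
      moreover have "right_limit_of (\<sigma> x) A"
        unfolding right_limit_of_def
      proof (intro conjI allI impI)
        show "\<exists>c. \<sigma> x < c"
          using meets[of "{x<..}" "\<sigma> x"] L above by auto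
        show "\<exists>s\<in>A. \<sigma> x < s \<and> s < c" if "\<sigma> x < c" for c
          using meets[of "{x<..<c}" "\<sigma> x"] L above that by auto
      qed
      ultimately show ?thesis
        using L eq by (auto simp: gap_of_def)
    qed
    have lim: "left_limit_of x A" "right_limit_of (\<sigma> x) A" "jump x (\<sigma> x)" "x < \<sigma> x" if "x \<in> X" for x
      using gap[OF that] that by (auto simp: gap_of_def X_def)
    have sep: "\<exists>a\<in>A. x < a \<and> a < y" if "x \<in> X" "y \<in> X" "x < y" for x y
      using left_limit_ofD(2)[OF lim(1)[OF that(2)] that(3)] .
    have order: "\<sigma> x < y" if "x \<in> X" "y \<in> X" "x < y" for x y
      using sep[OF that] jump[OF lim(3)[OF that(1)]] AL by (metis order_le_less_trans subsetD)
    have "\<exists>Y\<subseteq>X. Y \<noteq> {} \<and> (\<forall>y\<in>Y. \<forall>s\<in>A.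
        (s < y \<longrightarrow> (\<exists>z\<in>Y. s < z \<and> z < y)) \<and> (y < s \<longrightarrow> (\<exists>z\<in>Y. y < z \<and> z < s)))"
      by (rule two_sided_condensation[OF False A sep])
    then obtain Y where Y: "Y \<subseteq> X" "Y \<noteq> {}"
        and Y_dense: "\<forall>y\<in>Y. \<forall>s\<in>A.
          (s < y \<longrightarrow> (\<exists>z\<in>Y. s < z \<and> z < y)) \<and> (y < s \<longrightarrow> (\<exists>z\<in>Y. y < z \<and> z < s))"
      by (elim exE conjE)
    obtain P where P: "bounded_projection P" "range P = F"
      using compl[OF F(1)] by (auto simp: complemented_def)
    obtain x0 where x0: "x0 \<in> Y"
      using Y(2) by blast
    \<comment> \<open>In \<open>Y\<close> gaps accumulate on both sides of every gap, so each has
      every finite rank and the constantly true rank is admissible.\<close>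
    have bound: "real (Suc n) / 3 \<le> 1 + onorm P" for n
    proof (rule gap_rank_bounded[where N = A and X = Y and p = "\<lambda>x. x" and q = \<sigma>
          and Rk = "\<lambda>_ _. True" and i = x0])
      show "\<sigma> x < y \<or> \<sigma> y < x" if "x \<in> Y" "y \<in> Y" "x \<noteq> y" for x y
        using order[of x y] order[of y x] that Y(1) by (cases x y rule: linorder_cases) auto
      show "\<exists>z\<in>Y. True \<and> \<sigma> x < z \<and> \<sigma> z < c" if x: "x \<in> Y" "\<sigma> x < c" for x c
      proof -
        have xX: "x \<in> X"
          using x Y(1) by blast
        obtain s where s: "s \<in> A" "\<sigma> x < s" "s < c"
          using right_limit_ofD(2)[OF lim(2)[OF xX] x(2)] by blast
        have "x < s"
          using lim(4)[OF xX] s(2) by simp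
        then obtain z where z: "z \<in> Y" "x < z" "z < s"
          using Y_dense x(1) s(1) by blast
        then have "\<sigma> z \<le> s"
          using jump[OF lim(3), of z s] Y(1) s(1) AL by auto
        then show ?thesis
          using z s(3) order[OF xX, of z] Y(1) by (intro bexI[where x = z]) auto
      qed
      show "\<exists>z\<in>Y. True \<and> c < z \<and> \<sigma> z < x" if x: "x \<in> Y" "c < x" for x c
      proof -
        have xX: "x \<in> X"
          using x Y(1) by blast
        obtain s where s: "s \<in> A" "c < s" "s < x"
          using left_limit_ofD(2)[OF lim(1)[OF xX] x(2)] by blast
        then obtain z where z: "z \<in> Y" "s < z" "z < x"
          using Y_dense x(1) s(1,3) by blast
        then show ?thesis
          using s(2) order[of z x] xX Y(1) by (intro bexI[where x = z]) auto
      qed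
    qed (use comp P steps gap Y(1) x0 in auto)
    obtain n :: nat where "3 * (1 + onorm P) < real n"
      using reals_Archimedean2 by blast
    then have False
      using bound[of n] by simp
    then show ?thesis ..
  qed
qed

section \<open>Consequences for the internal order and for small norms\<close>

text \<open>If the internal orders were unbounded, countably many points would witness it. One
  member of the family handles them all, and the norm of a single projection onto it would exceed
  every bound.\<close>

lemma complemented_closed_cofinal_imp_io_finite:
  fixes \<F> :: "('a::linorder_topology \<Rightarrow>\<^sub>C real) set set"
  assumes comp: "compact (UNIV :: 'a set)" and cc: "closed_cofinal \<F>"
    and compl: "\<And>F. F \<in> \<F> \<Longrightarrow> complemented F"
  shows "io (internal_uncountable_points :: 'a set) < \<infinity>"
proof (rule ccontr)
  let ?M = "internal_uncountable_points :: 'a set"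
  assume "\<not> io ?M < \<infinity>"
  then have sup: "(SUP x\<in>?M. io_at x ?M) = \<infinity>"
    by (auto simp: io_def one_ereal_def split: if_splits)
  have "\<exists>x\<in>?M. \<exists>m\<ge>n. io_ge ?M m x" for n
  proof -
    have "enat n < (SUP x\<in>?M. io_at x ?M)"
      by (simp add: sup)
    then obtain x where "x \<in> ?M" "enat n < io_at x ?M"
      by (auto simp: less_SUP_iff)
    moreover from this obtain m where "n < m" "io_ge ?M m x"
      by (auto simp: io_at_def less_Sup_iff)
    ultimately show ?thesis
      using less_imp_le by blast
  qed
  then obtain x m where x: "\<And>n. x n \<in> ?M" "\<And>n. n \<le> m n" "\<And>n. io_ge ?M (m n) (x n)"
    by metis
  have x_range: "countable (range x)" "range x \<subseteq> ?M"
    using x(1) by auto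
  obtain F where F: "F \<in> \<F>"
    "\<And>P y n. bounded_projection P \<Longrightarrow> range P = F \<Longrightarrow> y \<in> range x \<Longrightarrow> io_ge ?M n y \<Longrightarrow>
      real (Suc n) / 3 \<le> 1 + onorm P"
    using closed_cofinal_projection_bounds[OF comp cc x_range] by metis
  obtain P where P: "bounded_projection P" "range P = F"
    using compl[OF F(1)] by (auto simp: complemented_def)
  obtain n :: nat where "3 * (1 + onorm P) < real n"
    using reals_Archimedean2 by blast
  then show False
    using F(2)[OF P rangeI x(3)[of n]] x(2)[of n] by simp
qed

lemma small_norm_closed_cofinal_imp_no_internal_uncountable:
  fixes \<F> :: "('a::linorder_topology \<Rightarrow>\<^sub>C real) set set"
  assumes comp: "compact (UNIV :: 'a set)" and cc: "closed_cofinal \<F>" and "k < 2"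
    and proj: "\<And>F. F \<in> \<F> \<Longrightarrow> \<exists>P. bounded_projection P \<and> range P = F \<and> onorm P \<le> k"
  shows "(internal_uncountable_points :: 'a set) = {}"
proof (rule ccontr)
  assume "internal_uncountable_points \<noteq> ({} :: 'a set)"
  then obtain x :: 'a where "x \<in> internal_uncountable_points"
    by blast
  then have x: "countable {x}" "{x} \<subseteq> internal_uncountable_points"
    by auto
  obtain F where F: "F \<in> \<F>"
    "\<And>P. bounded_projection P \<Longrightarrow> range P = F \<Longrightarrow> 2 \<le> onorm P"
    using closed_cofinal_projection_bounds[OF comp cc x] by (metis insert_not_empty)
  then show False
    using proj[OF F(1)] \<open>k < 2\<close> by force
qed

theorem theorem3p11:
  fixes M :: "'a::linorder_topology set"
  assumes "compact (UNIV :: 'a set)"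
    and "M = internal_uncountable_points"
    and "continuous_SCP TYPE('a \<Rightarrow>\<^sub>C real)"
  shows "aleph0_monolithic (euclidean :: 'a topology) \<and> io M < \<infinity> \<and>
    ((\<exists>k. 1 \<le> k \<and> k < 2 \<and> continuous_k_SCP k TYPE('a \<Rightarrow>\<^sub>C real)) \<longrightarrow> M = {})"
proof (intro conjI impI)
  obtain \<F> :: "('a \<Rightarrow>\<^sub>C real) set set" where \<F>: "closed_cofinal \<F>"
    "\<And>F. F \<in> \<F> \<Longrightarrow> complemented F"
    using assms(3) by (auto simp: continuous_SCP_def)
  show "aleph0_monolithic (euclidean :: 'a topology)"
    using complemented_closed_cofinal_imp_metrizable_closure[OF assms(1) \<F>]
    by (auto simp: aleph0_monolithic_def)
  show "io M < \<infinity>"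
    using complemented_closed_cofinal_imp_io_finite[OF assms(1) \<F>] assms(2) by simp
  assume "\<exists>k. 1 \<le> k \<and> k < 2 \<and> continuous_k_SCP k TYPE('a \<Rightarrow>\<^sub>C real)"
  then obtain k and \<G> :: "('a \<Rightarrow>\<^sub>C real) set set" where \<G>: "closed_cofinal \<G>" "k < 2"
    "\<And>F. F \<in> \<G> \<Longrightarrow> \<exists>P. bounded_projection P \<and> range P = F \<and> onorm P \<le> k"
    by (auto simp: continuous_k_SCP_def)
  show "M = {}"
    using small_norm_closed_cofinal_imp_no_internal_uncountable[OF assms(1) \<G>] assms(2) by simp
qed

end
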